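(* Let $\alpha$ be a countable (or finite) ordinal number. Then there is an entire function $f=f_\alpha$ such that the family $F(f)=\{f(nz):n\in\mathbb{N}\}$ is a $Q_\alpha$-normal family on the unit disk $\Delta=\{|z|<1\}$, but is not a $Q_\beta$-normal family on $\Delta$ for any ordinal $\beta<\alpha$. Moreover, if $\alpha$ has an immediate predecessor $\alpha-1$, and $\nu\ge 1$ is an integer or $\nu=\infty$, then there is an entire function $f=f_{\alpha,\nu}$ such that $F(f)$ is $Q_\alpha$-normal of exact order $\nu$ on $\Delta$ (respectively, $Q_\alpha$-normal of infinite order on $\Delta$ if $\nu=\infty$).
   Context: Let $D\subset\mathbb{C}$ be a domain and $S=\{f_n\}$ a sequence of meromorphic functions on $D$. A point $z_0\in D$ is a $C_0$-point of $S$ if there is a disk $\Delta(z_0,r)=\{|z-z_0|<r\}\subset D$ on which $S$ converges uniformly with respect to the spherical metric (the limit function may be identically $\infty$). For an ordinal $\alpha\ge 1$, $C_\alpha$-points are defined by transfinite recursion: (1) if $\alpha$ has an immediate predecessor $\alpha-1$, then $z_0\in D$ is a $C_\alpha$-point of $S$ if there is $r>0$ with $\Delta(z_0,r)\subset D$ such that each point of $\{0<|z-z_0|<r\}$ is a $C_{\alpha-1}$-point of $S$; (2) if $\alpha$ is a limit ordinal, $z_0$ is a $C_\alpha$-point of $S$ if it is a $C_\beta$-point of $S$ for some $\beta<\alpha$. A point of $D$ that is not a $C_\alpha$-point is called a non$C_\alpha$-point. $S$ is a $C_\alpha$-sequence in $D$ if every point of $D$ is a $C_\alpha$-point of $S$.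 A family $F$ of meromorphic functions on $D$ is $Q_\alpha$-normal in $D$ if every sequence of functions of $F$ has a subsequence which is a $C_\alpha$-sequence in $D$. Let $\alpha$ be a countable ordinal with an immediate predecessor and $\nu\ge 0$ an integer. $F$ is $Q_\alpha$-normal of order at most $\nu$ in $D$ if every sequence of functions of $F$ has a subsequence which is a $C_\alpha$-sequence in $D$ and has at most $\nu$ non$C_{\alpha-1}$-points in $D$. For $\nu\ge 1$, $F$ is $Q_\alpha$-normal of exact order $\nu$ in $D$ if it is $Q_\alpha$-normal of order at most $\nu$ but not $Q_\alpha$-normal of order at most $\nu-1$ in $D$. $F$ is $Q_\alpha$-normal of infinite order in $D$ if it is $Q_\alpha$-normal in $D$ but not $Q_\alpha$-normal of order at most $\nu$ for any integer $\nu\ge 1$. *)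

theory Defs
  imports "HOL-Complex_Analysis.Complex_Analysis"
begin

section \<open>Countable ordinals\<close>

text \<open>
  A countable ordinal (finite ones included) is an isomorphism class of well-orders whose field is
  a set of natural numbers. Every ordinal below a countable ordinal is countable, so quantifying
  over the smaller elements of this type is quantifying over all smaller ordinals.
\<close>

quotient_type countable_ordinal = "nat rel" / partial: "\<lambda>r s. (r, s) \<in> ordIso"
proof (rule part_equivpI)
  show "\<exists>r :: nat rel. (r, r) \<in> ordIso"
    by (rule exI[of _ "{}"]) (simp add: ordIso_reflexive)
  show "symp (\<lambda>r s :: nat rel. (r, s) \<in> ordIso)"
    by (rule sympI) (rule ordIso_symmetric)
  show "transp (\<lambda>r s :: nat rel. (r, s) \<in> ordIso)"
    by (rule transpI) (rule ordIso_transitive)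
qed

instantiation countable_ordinal :: wellorder
begin

lift_definition less_eq_countable_ordinal :: "countable_ordinal \<Rightarrow> countable_ordinal \<Rightarrow> bool"
  is "\<lambda>r s. (r, s) \<in> ordLeq"
proof -
  fix r r' s s' :: "nat rel"
  assume "(r, r') \<in> ordIso" "(s, s') \<in> ordIso"
  then show "(r, s) \<in> ordLeq \<longleftrightarrow> (r', s') \<in> ordLeq"
    using ordIso_ordLeq_trans[OF _ ordLeq_ordIso_trans, of r' r s s']
      ordIso_ordLeq_trans[OF _ ordLeq_ordIso_trans, of r r' s' s] ordIso_symmetric
    by blast
qed

lift_definition less_countable_ordinal :: "countable_ordinal \<Rightarrow> countable_ordinal \<Rightarrow> bool"
  is "\<lambda>r s. (r, s) \<in> ordLess"
proof -
  fix r r' s s' :: "nat rel"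
  assume "(r, r') \<in> ordIso" "(s, s') \<in> ordIso"
  then show "(r, s) \<in> ordLess \<longleftrightarrow> (r', s') \<in> ordLess"
    using ordIso_ordLess_trans[OF _ ordLess_ordIso_trans, of r' r s s']
      ordIso_ordLess_trans[OF _ ordLess_ordIso_trans, of r r' s' s] ordIso_symmetric
    by blast
qed

instance
proof
  have WO: "Well_order r" if "(r, r) \<in> ordIso" for r :: "nat rel"
    using that unfolding ordIso_def by auto
  fix x y z :: countable_ordinal
  show "x < y \<longleftrightarrow> x \<le> y \<and> \<not> y \<le> x"
  proof transfer
    fix r s :: "nat rel"
    assume "(r, r) \<in> ordIso" "(s, s) \<in> ordIso"
    then show "(r, s) \<in> ordLess \<longleftrightarrow> (r, s) \<in> ordLeq \<and> (s, r) \<notin> ordLeq"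
      using not_ordLeq_iff_ordLess[OF WO WO, of r s] ordLess_imp_ordLeq[of r s] by blast
  qed
  show "x \<le> x"
    by transfer (rule ordIso_imp_ordLeq)
  show "x \<le> z" if "x \<le> y" "y \<le> z"
    using that by transfer (rule ordLeq_transitive)
  show "x = y" if "x \<le> y" "y \<le> x"
    using that by transfer (simp add: ordIso_iff_ordLeq)
  show "x \<le> y \<or> y \<le> x"
    by transfer (rule ordLeq_total[OF WO WO])
next
  fix P :: "countable_ordinal \<Rightarrow> bool" and a :: countable_ordinal
  assume step: "\<And>x. (\<And>y. y < x \<Longrightarrow> P y) \<Longrightarrow> P x"
  have "P (abs_countable_ordinal r)" if "(r, r) \<in> ordIso" for r :: "nat rel"
    using that
  proof (induction r rule: wf_induct_rule[OF wf_ordLess])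
    case (1 r)
    show ?case
    proof (rule step)
      fix y assume y: "y < abs_countable_ordinal r"
      obtain s where s: "(s, s) \<in> ordIso" "y = abs_countable_ordinal s"
        by (induction y rule: countable_ordinal.abs_induct) blast
      have "(s, r) \<in> ordLess"
        using y s 1(2) by (simp add: less_countable_ordinal.abs_eq)
      then show "P y"
        using 1(1) s by blast
    qed
  qed
  then show "P a"
    by (rule countable_ordinal.abs_induct)
qed

end

instantiation countable_ordinal :: zero
begin

lift_definition zero_countable_ordinal :: countable_ordinal is "{}"
  by (rule ordIso_reflexive) simp

instance ..

end

lemma zero_le_countable_ordinal [simp]: "0 \<le> (\<alpha> :: countable_ordinal)"
proof transfer
  fix r :: "nat rel"
  assume "(r, r) \<in> ordIso"
  then have "Well_order r"
    unfolding ordIso_def by auto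
  then show "({}, r) \<in> ordLeq"
    unfolding ordLeq_def embed_def bij_betw_def by auto
qed

definition is_pred :: "countable_ordinal \<Rightarrow> countable_ordinal \<Rightarrow> bool" where
  "is_pred \<beta> \<alpha> \<longleftrightarrow> \<beta> < \<alpha> \<and> (\<forall>\<gamma><\<alpha>. \<gamma> \<le> \<beta>)"

definition has_pred :: "countable_ordinal \<Rightarrow> bool" where
  "has_pred \<alpha> \<longleftrightarrow> (\<exists>\<beta>. is_pred \<beta> \<alpha>)"

definition opred :: "countable_ordinal \<Rightarrow> countable_ordinal" where
  "opred \<alpha> = (THE \<beta>. is_pred \<beta> \<alpha>)"

lemma opred_eqI: "is_pred \<beta> \<alpha> \<Longrightarrow> opred \<alpha> = \<beta>"
  unfolding opred_def by (rule the_equality) (auto simp: is_pred_def intro: antisym)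

lemma opred_less: "has_pred \<alpha> \<Longrightarrow> opred \<alpha> < \<alpha>"
  unfolding has_pred_def using opred_eqI by (auto simp: is_pred_def)


section \<open>The Riemann sphere with the spherical metric\<close>

datatype riemann_sphere = Finite complex | Infinity

text \<open>Stereographic projection to the unit sphere of \<open>\<complex> \<times> \<real>\<close>, from the north pole \<open>(0, 1)\<close>.\<close>

fun stereo :: "riemann_sphere \<Rightarrow> complex \<times> real" where
  "stereo (Finite z) = ((2 / (1 + (cmod z)\<^sup>2)) *\<^sub>R z, ((cmod z)\<^sup>2 - 1) / ((cmod z)\<^sup>2 + 1))"
| "stereo Infinity = (0, 1)"

lemma norm_stereo [simp]: "norm (stereo p) = 1"
proof (cases p)
  case (Finite z)
  have "1 + (cmod z)\<^sup>2 \<noteq> 0"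
    by (smt (verit) zero_le_power2)
  then have "(2 / (1 + (cmod z)\<^sup>2) * cmod z)\<^sup>2 + (((cmod z)\<^sup>2 - 1) / ((cmod z)\<^sup>2 + 1))\<^sup>2 = 1"
    by (simp add: field_simps) (simp add: power2_eq_square algebra_simps)
  then show ?thesis
    using Finite by (simp add: norm_prod_def power_mult_distrib power_divide)
qed simp

lemma stereo_eq_iff [simp]: "stereo p = stereo q \<longleftrightarrow> p = q"
proof
  have pos: "1 + (cmod z)\<^sup>2 \<noteq> 0" for z
    by (smt (verit) zero_le_power2)
  have *: "((cmod z)\<^sup>2 - 1) / ((cmod z)\<^sup>2 + 1) = 1 - 2 / (1 + (cmod z)\<^sup>2)" for z
    using pos[of z] by (simp add: field_simps)
  assume "stereo p = stereo q"
  then show "p = q"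
    using pos by (cases p; cases q) (auto simp: * simp del: scaleR_complex.simps)
qed simp

text \<open>
  The spherical distance is the length of the shorter great-circle arc, i.e. the angle between the
  two points of the unit sphere. This is the metric with line element \<open>2 \<bar>dz\<bar> / (1 + \<bar>z\<bar>\<^sup>2)\<close>.
\<close>

lemma arccos_inner_triangle:
  fixes x y z :: "'a :: real_inner"
  assumes [simp]: "norm x = 1" "norm y = 1" "norm z = 1"
  shows "arccos (x \<bullet> z) \<le> arccos (x \<bullet> y) + arccos (y \<bullet> z)"
proof -
  have bd: "-1 \<le> u \<bullet> v \<and> u \<bullet> v \<le> 1" if "norm u = 1" "norm v = 1" for u v :: 'a
    using Cauchy_Schwarz_ineq2[of u v] that by auto
  define a where "a = arccos (x \<bullet> y)"
  define b where "b = arccos (y \<bullet> z)"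
  have ab: "0 \<le> a" "a \<le> pi" "0 \<le> b" "b \<le> pi" "cos a = x \<bullet> y" "cos b = y \<bullet> z"
    using bd[of x y] bd[of y z] by (auto simp: a_def b_def arccos_lbound arccos_ubound)
  have self: "x \<bullet> x = 1" "y \<bullet> y = 1" "z \<bullet> z = 1"
    by (simp_all add: dot_square_norm)
  define u where "u = x - (x \<bullet> y) *\<^sub>R y"
  define v where "v = z - (y \<bullet> z) *\<^sub>R y"
  have nu: "norm u = sin a"
  proof -
    have "(norm u)\<^sup>2 = (sin a)\<^sup>2"
      unfolding sin_squared_eq ab power2_norm_eq_inner u_def
      by (simp add: inner_simps self power2_eq_square inner_commute)
    then show ?thesis
      using ab by (simp add: sin_ge_zero)
  qed
  have nv: "norm v = sin b"
  proof -
    have "(norm v)\<^sup>2 = (sin b)\<^sup>2"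
      unfolding sin_squared_eq ab power2_norm_eq_inner v_def
      by (simp add: inner_simps self power2_eq_square inner_commute)
    then show ?thesis
      using ab by (simp add: sin_ge_zero)
  qed
  have "u \<bullet> v = x \<bullet> z - cos a * cos b"
    unfolding u_def v_def ab by (simp add: inner_simps self inner_commute)
  moreover have "\<bar>u \<bullet> v\<bar> \<le> sin a * sin b"
    using Cauchy_Schwarz_ineq2[of u v] by (simp add: nu nv)
  ultimately have cos_le: "cos (a + b) \<le> x \<bullet> z"
    by (simp add: cos_add)
  show ?thesis
  proof (cases "a + b \<le> pi")
    case True
    have "arccos (x \<bullet> z) \<le> arccos (cos (a + b))"
      using cos_le bd[of x z] by (intro arccos_le_arccos) auto
    then show ?thesis
      using True ab by (simp add: arccos_cos a_def b_def)
  next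
    case False
    then show ?thesis
      using arccos_ubound[of "x \<bullet> z"] bd[of x z] by (simp add: a_def b_def)
  qed
qed

instantiation riemann_sphere :: metric_space
begin

definition dist_riemann_sphere :: "riemann_sphere \<Rightarrow> riemann_sphere \<Rightarrow> real" where
  "dist_riemann_sphere p q = arccos (stereo p \<bullet> stereo q)"

definition uniformity_riemann_sphere :: "(riemann_sphere \<times> riemann_sphere) filter" where
  "uniformity_riemann_sphere = (INF e\<in>{0<..}. principal {(p, q). dist p q < e})"

definition open_riemann_sphere :: "riemann_sphere set \<Rightarrow> bool" where
  "open_riemann_sphere U \<longleftrightarrow> (\<forall>x\<in>U. eventually (\<lambda>(x', y). x' = x \<longrightarrow> y \<in> U) uniformity)"

instance
proof
  fix p q r :: riemann_sphere
  show "dist p q = 0 \<longleftrightarrow> p = q"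
  proof -
    have "dist p q = 0 \<longleftrightarrow> stereo p \<bullet> stereo q = 1"
      using Cauchy_Schwarz_ineq2[of "stereo p" "stereo q"]
      by (auto simp: dist_riemann_sphere_def arccos_1) (smt (verit) cos_arccos cos_zero)
    also have "\<dots> \<longleftrightarrow> stereo p = stereo q"
      using norm_cauchy_schwarz_eq[of "stereo p" "stereo q"] by auto
    finally show ?thesis
      by simp
  qed
  show "dist p q \<le> dist p r + dist q r"
    using arccos_inner_triangle[of "stereo p" "stereo r" "stereo q"]
    by (simp add: dist_riemann_sphere_def inner_commute)
qed (simp_all add: uniformity_riemann_sphere_def open_riemann_sphere_def)

end


section \<open>\<open>C\<^sub>\<alpha>\<close>-points and \<open>Q\<^sub>\<alpha>\<close>-normal families\<close>

text \<open>
  Meromorphic functions are represented as in the library by functions on \<open>\<complex>\<close> that are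
  \<^const>\<open>nicely_meromorphic_on\<close> the domain, the value at a pole being a dummy. Throughout this
  section it is understood that \<open>D\<close> is a domain and that the members of the sequence \<open>S\<close>, or of the
  family \<open>F\<close>, are such functions.
\<close>

definition sphere_val :: "(complex \<Rightarrow> complex) \<Rightarrow> complex \<Rightarrow> riemann_sphere" where
  "sphere_val f z = (if is_pole f z then Infinity else Finite (f z))"

definition C0_point :: "complex set \<Rightarrow> (nat \<Rightarrow> complex \<Rightarrow> complex) \<Rightarrow> complex \<Rightarrow> bool" where
  "C0_point D S z \<longleftrightarrow>
     (\<exists>r>0. ball z r \<subseteq> D \<and>
        (\<exists>g. uniform_limit (ball z r) (\<lambda>n. sphere_val (S n)) g sequentially))"

function C_point ::
  "complex set \<Rightarrow> (nat \<Rightarrow> complex \<Rightarrow> complex) \<Rightarrow> countable_ordinal \<Rightarrow> complex \<Rightarrow> bool" where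
  "C_point D S \<alpha> z \<longleftrightarrow>
     (if \<alpha> = 0 then C0_point D S z
      else if has_pred \<alpha> then
        \<exists>r>0. ball z r \<subseteq> D \<and> (\<forall>w\<in>ball z r - {z}. C_point D S (opred \<alpha>) w)
      else \<exists>\<beta>\<in>{..<\<alpha>}. C_point D S \<beta> z)"
  by pat_completeness auto
termination
  by (relation "inv_image {(\<beta>, \<alpha>). \<beta> < \<alpha>} (\<lambda>(D, S, \<alpha>, z). \<alpha>)")
     (auto simp: opred_less intro: wf_inv_image wf)

declare C_point.simps [simp del]

definition C_sequence ::
  "complex set \<Rightarrow> countable_ordinal \<Rightarrow> (nat \<Rightarrow> complex \<Rightarrow> complex) \<Rightarrow> bool" where
  "C_sequence D \<alpha> S \<longleftrightarrow> (\<forall>z\<in>D. C_point D S \<alpha> z)"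

definition nonC_points ::
  "complex set \<Rightarrow> countable_ordinal \<Rightarrow> (nat \<Rightarrow> complex \<Rightarrow> complex) \<Rightarrow> complex set" where
  "nonC_points D \<alpha> S = {z \<in> D. \<not> C_point D S \<alpha> z}"

definition Q_normal ::
  "complex set \<Rightarrow> countable_ordinal \<Rightarrow> (complex \<Rightarrow> complex) set \<Rightarrow> bool" where
  "Q_normal D \<alpha> F \<longleftrightarrow>
     (\<forall>S :: nat \<Rightarrow> complex \<Rightarrow> complex. range S \<subseteq> F \<longrightarrow>
        (\<exists>k :: nat \<Rightarrow> nat. strict_mono k \<and> C_sequence D \<alpha> (S \<circ> k)))"

text \<open>The notions of order below are meant for \<open>\<alpha>\<close> with \<^term>\<open>has_pred \<alpha>\<close>.\<close>

definition Q_normal_order_le ::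
  "complex set \<Rightarrow> countable_ordinal \<Rightarrow> nat \<Rightarrow> (complex \<Rightarrow> complex) set \<Rightarrow> bool" where
  "Q_normal_order_le D \<alpha> \<nu> F \<longleftrightarrow>
     (\<forall>S :: nat \<Rightarrow> complex \<Rightarrow> complex. range S \<subseteq> F \<longrightarrow>
        (\<exists>k :: nat \<Rightarrow> nat. strict_mono k \<and> C_sequence D \<alpha> (S \<circ> k) \<and>
           finite (nonC_points D (opred \<alpha>) (S \<circ> k)) \<and>
           card (nonC_points D (opred \<alpha>) (S \<circ> k)) \<le> \<nu>))"

text \<open>Only used for \<open>\<nu> \<ge> 1\<close>.\<close>

definition Q_normal_exact_order ::
  "complex set \<Rightarrow> countable_ordinal \<Rightarrow> nat \<Rightarrow> (complex \<Rightarrow> complex) set \<Rightarrow> bool" where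
  "Q_normal_exact_order D \<alpha> \<nu> F \<longleftrightarrow>
     Q_normal_order_le D \<alpha> \<nu> F \<and> \<not> Q_normal_order_le D \<alpha> (\<nu> - 1) F"

definition Q_normal_infinite_order ::
  "complex set \<Rightarrow> countable_ordinal \<Rightarrow> (complex \<Rightarrow> complex) set \<Rightarrow> bool" where
  "Q_normal_infinite_order D \<alpha> F \<longleftrightarrow>
     Q_normal D \<alpha> F \<and> (\<forall>\<nu>\<ge>1. \<not> Q_normal_order_le D \<alpha> \<nu> F)"

definition dilations :: "(complex \<Rightarrow> complex) \<Rightarrow> (complex \<Rightarrow> complex) set" where
  "dilations f = {\<lambda>z. f (of_nat n * z) | n. n \<ge> 1}"

lemma dilations_nicely_meromorphic:
  assumes "f holomorphic_on UNIV" "g \<in> dilations f"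
  shows "g nicely_meromorphic_on D"
proof -
  obtain n where g: "g = f \<circ> (\<lambda>z. of_nat n * z)"
    using assms(2) by (auto simp: dilations_def o_def)
  have "g holomorphic_on UNIV"
    unfolding g by (intro holomorphic_on_compose holomorphic_intros holomorphic_on_subset[OF assms(1)]) auto
  then have "g analytic_on D"
    using analytic_on_holomorphic by blast
  then show ?thesis
    by (rule analytic_on_imp_nicely_meromorphic_on)
qed

end

theory Submission
  imports Defs
begin

text \<open>
  If \<open>S\<close> converges to \<open>\<infinity>\<close> locally uniformly off a closed countable set \<open>E\<close> and every point of \<open>E\<close> is a
  zero of almost all members of \<open>S\<close>, then the non-\<open>C\<^sub>\<beta>\<close>-points are exactly the \<open>\<beta>\<close>-th Cantor--Bendixson
  derivative of \<open>E\<close>. For countable compact sets \<open>K\<^sub>j\<close> shrinking to the point 1, place finite sets of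
  zeros \<open>4^(m^2) E\<^sub>m\<close> with \<open>E\<^sub>m \<subseteq> K\<^sub>j\<close>, where each type \<open>j = j(m)\<close> occurs infinitely often and
  \<open>E\<^sub>m\<close> exhausts \<open>K\<^sub>j\<close> along the \<open>m\<close> of type \<open>j\<close>. The scales grow so fast that the dilation by \<open>n\<close> of
  the resulting entire function (with an additional zero at the origin) sees at most one cluster in
  the unit disk, the other factors being dominated by the size of \<open>4^(m^2)\<close>. Hence every sequence of
  dilations has a subsequence whose exceptional set lies in \<open>{0} \<union> s K\<^sub>j\<close> for some \<open>s\<close>, or in \<open>{0, s}\<close>
  when the types tend to infinity, while \<open>{0} \<union> K\<^sub>j / 2\<close> does occur. It remains to choose the \<open>K\<^sub>j\<close> with
  suitable Cantor--Bendixson ranks.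
\<close>

section \<open>Ranked sets\<close>

text \<open>Every smaller ordinal is the type of a proper initial segment \<open>underS r a\<close>
  of a representing well-order, and \<open>a\<close> ranges over natural numbers. This allows all
  ordinals below \<gamma> to be enumerated in a sequence.\<close>

lemma countable_lessThan_countable_ordinal: "countable {..<\<gamma> :: countable_ordinal}"
proof -
  obtain r where r: "(r, r) \<in> ordIso" and \<gamma>: "\<gamma> = abs_countable_ordinal r"
    by (induction \<gamma> rule: countable_ordinal.abs_induct) blast
  have "{..<\<gamma>} \<subseteq> range (\<lambda>a. abs_countable_ordinal (Restr r (underS r a)))"
  proof
    fix \<beta> assume "\<beta> \<in> {..<\<gamma>}"
    obtain s where s: "(s, s) \<in> ordIso" and \<beta>: "\<beta> = abs_countable_ordinal s"
      by (induction \<beta> rule: countable_ordinal.abs_induct) blast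
    have "(s, r) \<in> ordLess"
      using \<open>\<beta> \<in> {..<\<gamma>}\<close> s r by (simp add: \<beta> \<gamma> less_countable_ordinal.abs_eq)
    moreover have "Well_order s" "Well_order r"
      using s r unfolding ordIso_def by auto
    ultimately obtain a where a: "(s, Restr r (underS r a)) \<in> ordIso"
      using ordLess_iff_ordIso_Restr by blast
    then have "(Restr r (underS r a), Restr r (underS r a)) \<in> ordIso"
      using ordIso_symmetric ordIso_transitive by blast
    then have "\<beta> = abs_countable_ordinal (Restr r (underS r a))"
      unfolding \<beta> using a s Quotient3_rel[OF Quotient3_countable_ordinal] by blast
    then show "\<beta> \<in> range (\<lambda>a. abs_countable_ordinal (Restr r (underS r a)))"
      by blast
  qed
  then show ?thesis
    by (rule countable_subset) simp
qed

text \<open>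
  A relation \<open>G\<close> assigns Cantor--Bendixson ranks to the points of the set \<open>fst ` G\<close>, where only the
  largest rank of a point matters. The condition \<open>scattered_ranks\<close> bounds the true rank from above
  and makes the set closed, \<open>attained_ranks\<close> bounds the true rank from below.
\<close>

definition scattered_ranks :: "(complex \<times> countable_ordinal) set \<Rightarrow> bool" where
  "scattered_ranks G \<longleftrightarrow>
     (\<forall>z. finite {a. (z, a) \<in> G} \<and>
        (\<exists>r>0. \<forall>w b. (w, b) \<in> G \<longrightarrow> w \<in> ball z r - {z} \<longrightarrow> (\<exists>a. (z, a) \<in> G \<and> b < a)))"

definition attained_ranks :: "(complex \<times> countable_ordinal) set \<Rightarrow> bool" where
  "attained_ranks G \<longleftrightarrow>
     (\<forall>(z, a)\<in>G. \<forall>\<beta><a. \<forall>r>0. \<exists>w b. (w, b) \<in> G \<and> w \<in> ball z r - {z} \<and> \<beta> \<le> b)"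

section \<open>Ranks determine which points are C-points\<close>

lemma not_has_predD:
  assumes "\<not> has_pred \<alpha>" "\<beta> < \<alpha>"
  shows "\<exists>\<gamma>. \<beta> < \<gamma> \<and> \<gamma> < \<alpha>"
  using assms unfolding has_pred_def is_pred_def by (meson not_le)

lemma is_pred_opred: "has_pred \<alpha> \<Longrightarrow> is_pred (opred \<alpha>) \<alpha>"
  unfolding has_pred_def using opred_eqI by blast

lemma le_opred: "has_pred \<alpha> \<Longrightarrow> \<beta> < \<alpha> \<Longrightarrow> \<beta> \<le> opred \<alpha>"
  using is_pred_opred by (auto simp: is_pred_def)

text \<open>Induction on \<alpha>. At a successor, ranks of points near \<open>z\<close> lie
  strictly below some rank of \<open>z\<close>, hence below \<open>opred \<alpha>\<close>. At a
  limit, the ranks of \<open>z\<close> are finite in number, so some \<beta> < \<alpha> still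
  exceeds all of them.\<close>

lemma C_point_if_ranks_less:
  assumes D: "open D" and G: "scattered_ranks G"
    and C0: "\<And>z. z \<in> D \<Longrightarrow> z \<notin> fst ` G \<Longrightarrow> C0_point D S z"
    and z: "z \<in> D" "\<And>a. (z, a) \<in> G \<Longrightarrow> a < \<alpha>"
  shows "C_point D S \<alpha> z"
  using z
proof (induction \<alpha> arbitrary: z rule: less_induct)
  case (less \<alpha>)
  consider "\<alpha> = 0" | "\<alpha> \<noteq> 0" "has_pred \<alpha>" | "\<alpha> \<noteq> 0" "\<not> has_pred \<alpha>"
    by blast
  then show ?case
  proof cases
    case 1
    have "(z, a) \<notin> G" for a
      using less.prems(2)[of a] zero_le_countable_ordinal[of a] 1 leD by blast
    then have "z \<notin> fst ` G"
      by force
    then show ?thesis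
      using C0 less.prems 1 by (subst C_point.simps) auto
  next
    case 2
    obtain r where r: "r > 0"
      "\<And>w b. (w, b) \<in> G \<Longrightarrow> w \<in> ball z r - {z} \<Longrightarrow> \<exists>a. (z, a) \<in> G \<and> b < a"
      using G unfolding scattered_ranks_def by blast
    obtain e where e: "e > 0" "ball z e \<subseteq> D"
      using D less.prems(1) open_contains_ball by blast
    have "C_point D S (opred \<alpha>) w" if w: "w \<in> ball z (min r e) - {z}" for w
    proof (rule less.IH)
      show "opred \<alpha> < \<alpha>"
        using opred_less 2 by blast
      show "w \<in> D"
        using w e by auto
      fix b assume "(w, b) \<in> G"
      then obtain a where "(z, a) \<in> G" "b < a"
        using r(2)[of w b] w by auto
      then show "b < opred \<alpha>"
        using less.prems(2) le_opred[OF 2(2)] order_less_le_trans by blast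
    qed
    moreover have "ball z (min r e) \<subseteq> D" "min r e > 0"
      using e r by auto
    ultimately have "\<exists>r>0. ball z r \<subseteq> D \<and> (\<forall>w\<in>ball z r - {z}. C_point D S (opred \<alpha>) w)"
      by blast
    then show ?thesis
      using 2 by (subst C_point.simps) simp
  next
    case 3
    define A where "A = {a. (z, a) \<in> G}"
    have A: "finite A"
      using G unfolding scattered_ranks_def A_def by blast
    have "0 < \<alpha>"
      using 3 by (simp add: order_less_le)
    have "\<exists>\<beta><\<alpha>. \<forall>a\<in>A. a < \<beta>"
    proof (cases "A = {}")
      case False
      then have "Max A < \<alpha>"
        using A less.prems(2) by (auto simp: A_def)
      then show ?thesis
        using not_has_predD[OF 3(2)] A Max_ge order_le_less_trans by meson
    qed (use \<open>0 < \<alpha>\<close> in auto)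
    then obtain \<beta> where "\<beta> < \<alpha>" "\<And>a. (z, a) \<in> G \<Longrightarrow> a < \<beta>"
      unfolding A_def by blast
    then show ?thesis
      using 3 less.IH[of \<beta> z] less.prems(1) by (subst C_point.simps) auto
  qed
qed

text \<open>Induction on \<alpha>. At a successor, \<open>opred \<alpha> < a\<close> puts points of
  rank at least \<open>opred \<alpha>\<close> into every punctured disk about \<open>z\<close>. At a
  limit, the same rank \<open>a\<close> dominates every \<beta> < \<alpha>.\<close>

lemma not_C_point_if_rank_ge:
  assumes G: "attained_ranks G"
    and C0: "\<And>z. z \<in> fst ` G \<Longrightarrow> \<not> C0_point D S z"
    and z: "(z, a) \<in> G" "\<alpha> \<le> a"
  shows "\<not> C_point D S \<alpha> z"
  using z
proof (induction \<alpha> arbitrary: z a rule: less_induct)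
  case (less \<alpha>)
  consider "\<alpha> = 0" | "\<alpha> \<noteq> 0" "has_pred \<alpha>" | "\<alpha> \<noteq> 0" "\<not> has_pred \<alpha>"
    by blast
  then show ?case
  proof cases
    case 1
    then show ?thesis
      using C0[of z] less.prems by (subst C_point.simps) force
  next
    case 2
    have "\<exists>w\<in>ball z r - {z}. \<not> C_point D S (opred \<alpha>) w" if "r > 0" for r
    proof -
      have "opred \<alpha> < a"
        using opred_less[OF 2(2)] less.prems by simp
      then obtain w b where "(w, b) \<in> G" "w \<in> ball z r - {z}" "opred \<alpha> \<le> b"
        using G less.prems(1) \<open>r > 0\<close> unfolding attained_ranks_def by blast
      then show ?thesis
        using less.IH opred_less[OF 2(2)] by blast
    qed
    then show ?thesis
      using 2 by (subst C_point.simps) auto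
  next
    case 3
    then show ?thesis
      using less by (subst C_point.simps) (auto dest: order_less_imp_le)
  qed
qed

section \<open>Unions and scalings of ranked sets\<close>

lemma scattered_ranks_Un:
  assumes "scattered_ranks G" "scattered_ranks H"
  shows "scattered_ranks (G \<union> H)"
  unfolding scattered_ranks_def
proof (intro allI conjI)
  fix z
  have "{a. (z, a) \<in> G \<union> H} = {a. (z, a) \<in> G} \<union> {a. (z, a) \<in> H}"
    by blast
  then show "finite {a. (z, a) \<in> G \<union> H}"
    using assms unfolding scattered_ranks_def by simp
  obtain r where r: "r > 0"
    "\<And>w b. (w, b) \<in> G \<Longrightarrow> w \<in> ball z r - {z} \<Longrightarrow> \<exists>a. (z, a) \<in> G \<and> b < a"
    using assms(1) unfolding scattered_ranks_def by blast
  obtain s where s: "s > 0"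
    "\<And>w b. (w, b) \<in> H \<Longrightarrow> w \<in> ball z s - {z} \<Longrightarrow> \<exists>a. (z, a) \<in> H \<and> b < a"
    using assms(2) unfolding scattered_ranks_def by blast
  show "\<exists>r>0. \<forall>w b. (w, b) \<in> G \<union> H \<longrightarrow> w \<in> ball z r - {z} \<longrightarrow> (\<exists>a. (z, a) \<in> G \<union> H \<and> b < a)"
  proof (intro exI[of _ "min r s"] conjI allI impI)
    fix w b assume "(w, b) \<in> G \<union> H" "w \<in> ball z (min r s) - {z}"
    then show "\<exists>a. (z, a) \<in> G \<union> H \<and> b < a"
      using r(2)[of w b] s(2)[of w b] by auto
  qed (use r s in auto)
qed

lemma scattered_ranks_empty: "scattered_ranks {}"
  by (auto simp: scattered_ranks_def intro: exI[of _ 1])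

lemma scattered_ranks_singleton: "scattered_ranks {(c, a)}"
  unfolding scattered_ranks_def
proof (intro allI conjI)
  fix z
  show "finite {b. (z, b) \<in> {(c, a)}}"
    by simp
  show "\<exists>r>0. \<forall>w b. (w, b) \<in> {(c, a)} \<longrightarrow> w \<in> ball z r - {z} \<longrightarrow>
      (\<exists>b'. (z, b') \<in> {(c, a)} \<and> b < b')"
    by (cases "z = c") (auto intro: exI[of _ 1] exI[of _ "dist z c"])
qed

lemma scattered_ranks_UN:
  assumes "finite I" "\<And>i. i \<in> I \<Longrightarrow> scattered_ranks (G i)"
  shows "scattered_ranks (\<Union>i\<in>I. G i)"
  using assms by (induction I) (auto intro: scattered_ranks_empty scattered_ranks_Un)

lemma scattered_ranks_scale:
  assumes G: "scattered_ranks G" and s: "s > 0"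
  shows "scattered_ranks (apfst ((*) (of_real s)) ` G)"
  unfolding scattered_ranks_def
proof (intro allI conjI)
  have [simp]: "(w, b) \<in> apfst ((*) (of_real s)) ` G \<longleftrightarrow> (w / of_real s, b) \<in> G" for w b
    using s by (force simp: image_iff field_simps)
  fix z :: complex
  show "finite {a. (z, a) \<in> apfst ((*) (of_real s)) ` G}"
    using G unfolding scattered_ranks_def by simp
  obtain r where r: "r > 0" "\<And>w b. (w, b) \<in> G \<Longrightarrow> w \<in> ball (z / of_real s) r - {z / of_real s} \<Longrightarrow>
      \<exists>a. (z / of_real s, a) \<in> G \<and> b < a"
    using G unfolding scattered_ranks_def by blast
  have "\<exists>a. (z / of_real s, a) \<in> G \<and> b < a"
    if "(w / of_real s, b) \<in> G" "w \<in> ball z (s * r) - {z}" for w b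
  proof (rule r(2)[OF that(1)])
    have "dist (z / of_real s) (w / of_real s) = dist z w / s"
      using s by (simp add: dist_norm diff_divide_distrib[symmetric] norm_divide)
    moreover have "dist z w / s < r"
      using that(2) s by (simp add: divide_less_eq mult.commute)
    ultimately show "w / of_real s \<in> ball (z / of_real s) r - {z / of_real s}"
      using that(2) s by auto
  qed
  then show "\<exists>r>0. \<forall>w b. (w, b) \<in> apfst ((*) (of_real s)) ` G \<longrightarrow> w \<in> ball z r - {z} \<longrightarrow>
      (\<exists>a. (z, a) \<in> apfst ((*) (of_real s)) ` G \<and> b < a)"
    using s r(1) by (intro exI[of _ "s * r"]) auto
qed

lemma attained_ranks_UN:
  assumes "\<And>i. i \<in> I \<Longrightarrow> attained_ranks (G i)"
  shows "attained_ranks (\<Union>i\<in>I. G i)"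
  unfolding attained_ranks_def
proof (clarify)
  fix z a i \<beta> and r :: real
  assume "i \<in> I" "(z, a) \<in> G i" "\<beta> < a" "r > 0"
  then obtain w b where "(w, b) \<in> G i" "w \<in> ball z r - {z}" "\<beta> \<le> b"
    using assms unfolding attained_ranks_def by blast
  then show "\<exists>w b. (w, b) \<in> (\<Union>i\<in>I. G i) \<and> w \<in> ball z r - {z} \<and> \<beta> \<le> b"
    using \<open>i \<in> I\<close> by blast
qed

lemma attained_ranks_Un:
  assumes "attained_ranks G" "attained_ranks H"
  shows "attained_ranks (G \<union> H)"
proof -
  have "attained_ranks (\<Union>b\<in>{True, False}. if b then G else H)"
    using assms by (intro attained_ranks_UN) simp
  then show ?thesis
    by (simp add: Un_commute)
qed

lemma attained_ranks_zero: "attained_ranks {(c, 0)}"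
  using leD[OF zero_le_countable_ordinal] unfolding attained_ranks_def by auto

lemma attained_ranks_scale:
  assumes G: "attained_ranks G" and s: "s > 0"
  shows "attained_ranks (apfst ((*) (of_real s)) ` G)"
  unfolding attained_ranks_def
proof clarsimp
  fix z a \<beta> and r :: real
  assume "(z, a) \<in> G" "\<beta> < a" "r > 0"
  moreover from \<open>r > 0\<close> have "r / s > 0"
    using s by simp
  ultimately obtain w b where w: "(w, b) \<in> G" "w \<in> ball z (r / s) - {z}" "\<beta> \<le> b"
    using G unfolding attained_ranks_def by blast
  have "dist (of_real s * z) (of_real s * w) = s * dist z w"
    using s by (simp add: dist_norm right_diff_distrib[symmetric] norm_mult)
  then have "of_real s * w \<in> ball (of_real s * z) r - {of_real s * z}"
    using w(2) s by (auto simp: field_simps)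
  then show "\<exists>w b. (w, b) \<in> apfst ((*) (of_real s)) ` G \<and> dist (of_real s * z) w < r \<and>
      w \<noteq> of_real s * z \<and> \<beta> \<le> b"
    using w by (intro exI[of _ "of_real s * w"] exI[of _ b]) force
qed

text \<open>The condition is imposed at unranked points too: such a point has no rank to exceed
  those of its neighbours, so a whole disk about it is free of ranked points.\<close>

lemma closed_fst_scattered_ranks:
  assumes "scattered_ranks G"
  shows "closed (fst ` G)"
  unfolding closed_def open_contains_ball
proof
  fix z assume z: "z \<in> - fst ` G"
  then obtain r where r: "r > 0"
    "\<And>w b. (w, b) \<in> G \<Longrightarrow> w \<in> ball z r - {z} \<Longrightarrow> \<exists>a. (z, a) \<in> G \<and> b < a"
    using assms unfolding scattered_ranks_def by blast
  have "ball z r \<subseteq> - fst ` G"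
    using r(2) z by force
  then show "\<exists>e>0. ball z e \<subseteq> - fst ` G"
    using r(1) by blast
qed

section \<open>Existence of ranked sets with prescribed top points\<close>

definition top_ranked ::
  "countable_ordinal \<Rightarrow> complex \<Rightarrow> real \<Rightarrow> (complex \<times> countable_ordinal) set \<Rightarrow> bool" where
  "top_ranked \<gamma> c r G \<longleftrightarrow>
     countable G \<and> scattered_ranks G \<and> attained_ranks G \<and> fst ` G \<subseteq> cball c r \<and>
     (c, \<gamma>) \<in> G \<and> (\<forall>(z, a)\<in>G. a \<le> \<gamma> \<and> (a = \<gamma> \<longrightarrow> z = c))"

text \<open>A point of rank \<open>\<gamma>\<close> is obtained by letting, for every \<open>\<beta> < \<gamma>\<close>, infinitely many small
  sets with a top point of rank \<open>\<beta>\<close> converge to it.\<close>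

lemma exists_ranks_top:
  fixes \<gamma> :: countable_ordinal and c :: complex
  assumes "r > 0"
  shows "\<exists>G. top_ranked \<gamma> c r G"
  using assms
proof (induction \<gamma> arbitrary: c r rule: less_induct)
  case (less \<gamma> c r)
  show ?case
  proof (cases "\<gamma> = 0")
    case True
    then show ?thesis
      using less.prems by (intro exI[of _ "{(c, 0)}"])
        (auto simp: top_ranked_def scattered_ranks_singleton attained_ranks_zero)
  next
    case False
    \<comment> \<open>Only the first component of the decoded pair selects the ordinal, so every
      ordinal below \<gamma> recurs for infinitely many \<open>i\<close>.\<close>
    define \<beta> where "\<beta> i = from_nat_into {..<\<gamma>} (fst (prod_decode i))" for i
    have "0 < \<gamma>"
      using False by (simp add: order_less_le)
    then have ne: "{..<\<gamma>} \<noteq> {}"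
      by blast
    have \<beta>: "\<beta> i < \<gamma>" for i
      using from_nat_into[OF ne] by (auto simp: \<beta>_def)
    \<comment> \<open>The \<open>i\<close>-th piece is centred at distance \<open>q i\<close> from
      \<open>c\<close> and has radius \<open>q i / 2\<close>: it misses \<open>c\<close> and lies
      within \<open>r / 2 ^ i\<close> of it.\<close>
    define q where "q i = r / 2 ^ (i + 1)" for i :: nat
    have q: "q i > 0" for i
      using less.prems by (simp add: q_def)
    define x where "x i = c + of_real (q i)" for i
    have "\<forall>i. \<exists>G. top_ranked (\<beta> i) (x i) (q i / 2) G"
      using less.IH[OF \<beta> half_gt_zero[OF q]] by blast
    then obtain G where "\<forall>i. top_ranked (\<beta> i) (x i) (q i / 2) (G i)"
      by (rule choice[THEN exE])
    then have G: "\<And>i. countable (G i)" "\<And>i. scattered_ranks (G i)"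
      "\<And>i. attained_ranks (G i)" "\<And>i. fst ` G i \<subseteq> cball (x i) (q i / 2)" "\<And>i. (x i, \<beta> i) \<in> G i"
      "\<And>i. \<forall>(z, a)\<in>G i. a \<le> \<beta> i \<and> (a = \<beta> i \<longrightarrow> z = x i)"
      unfolding top_ranked_def by blast+
    have G\<gamma>: "a < \<gamma>" if "(z, a) \<in> G i" for z a i
      using G(6)[of i] \<beta>[of i] that by auto
    define H where "H = insert (c, \<gamma>) (\<Union>i. G i)"
    have near: "dist c z \<le> r / 2 ^ i" and ne_c: "z \<noteq> c" if "(z, a) \<in> G i" for z a i
    proof -
      have "dist (x i) z \<le> q i / 2"
        using G(4)[of i] that by force
      moreover have "dist c (x i) = q i"
        using q[of i] by (simp add: x_def dist_norm)
      moreover have r: "r / 2 ^ i = 2 * q i"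
        by (simp add: q_def)
      ultimately show "dist c z \<le> r / 2 ^ i" "z \<noteq> c"
        using dist_triangle[of c z "x i"] q[of i] r by (auto simp: dist_commute)
    qed
    have small: "\<exists>N. \<forall>i\<ge>N. r / 2 ^ i < d" if "d > 0" for d
    proof -
      have "(\<lambda>i. r * (1 / 2) ^ i) \<longlonglongrightarrow> r * 0"
        by (intro tendsto_intros) auto
      then have "\<forall>\<^sub>F i in sequentially. r * (1 / 2) ^ i < d"
        using \<open>d > 0\<close> by (intro order_tendstoD(2)) auto
      then show ?thesis
        by (simp add: eventually_sequentially power_one_over field_simps)
    qed
    have "scattered_ranks H"
      unfolding scattered_ranks_def
    proof (intro allI)
      fix z
      show "finite {a. (z, a) \<in> H} \<and>
        (\<exists>r>0. \<forall>w b. (w, b) \<in> H \<longrightarrow> w \<in> ball z r - {z} \<longrightarrow> (\<exists>a. (z, a) \<in> H \<and> b < a))"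
      proof (cases "z = c")
        case True
        have "{a. (z, a) \<in> H} = {\<gamma>}"
          using True ne_c unfolding H_def by blast
        then show ?thesis
          using True G\<gamma> unfolding H_def by (auto intro!: exI[of _ 1])
      next
        case False
        then obtain N where N: "\<And>i. i \<ge> N \<Longrightarrow> r / 2 ^ i < dist c z / 2"
          using small[of "dist c z / 2"] by auto
        \<comment> \<open>Away from \<open>c\<close> only finitely many pieces matter, and a finite
          union of scattered pieces is scattered.\<close>
        define H' where "H' = (\<Union>i<N. G i)"
        have "scattered_ranks H'"
          unfolding H'_def using G(2) by (intro scattered_ranks_UN) auto
        then obtain e where fin: "finite {a. (z, a) \<in> H'}" and e: "e > 0"
          "\<And>w b. (w, b) \<in> H' \<Longrightarrow> w \<in> ball z e - {z} \<Longrightarrow> \<exists>a. (z, a) \<in> H' \<and> b < a"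
          unfolding scattered_ranks_def by blast
        have H': "(w, b) \<in> H'" if w: "(w, b) \<in> H" "w \<in> ball z (dist c z / 2)" for w b
        proof -
          have far: "dist c w > dist c z / 2"
            using dist_triangle[of c z w] w(2) by (simp add: dist_commute)
          then have "w \<noteq> c"
            by auto
          then obtain i where i: "(w, b) \<in> G i"
            using w(1) unfolding H_def by blast
          then have "i < N"
            using near[OF i] N[of i] far by (meson not_le order_less_trans order_le_less_trans)
          then show ?thesis
            using i unfolding H'_def by blast
        qed
        have sub: "H' \<subseteq> H"
          unfolding H_def H'_def by blast
        have "{a. (z, a) \<in> H} \<subseteq> {a. (z, a) \<in> H'}"
          using H' False by auto
        moreover have "\<exists>a. (z, a) \<in> H \<and> b < a"
          if "(w, b) \<in> H" "w \<in> ball z (min e (dist c z / 2)) - {z}" for w b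
          using e(2)[of w b] H'[of w b] that sub by auto
        ultimately show ?thesis
          using fin finite_subset e(1) False
          by (intro conjI exI[of _ "min e (dist c z / 2)"]) auto
      qed
    qed
    moreover have "attained_ranks H"
      unfolding attained_ranks_def
    proof (intro ballI, unfold split_paired_all prod.case, intro allI impI)
      fix z a \<delta> and e :: real
      assume "(z, a) \<in> H" "\<delta> < a" "e > 0"
      then consider "z = c" "a = \<gamma>" | i where "(z, a) \<in> G i"
        unfolding H_def by blast
      then show "\<exists>w b. (w, b) \<in> H \<and> w \<in> ball z e - {z} \<and> \<delta> \<le> b"
      proof cases
        case 1
        obtain N where N: "\<And>i. i \<ge> N \<Longrightarrow> r / 2 ^ i < e"
          using small[OF \<open>e > 0\<close>] by blast
        \<comment> \<open>A piece whose top rank is exactly \<delta> and whose index is at least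
          \<open>N\<close>, hence close enough to \<open>c\<close>.\<close>
        define i where "i = prod_encode (to_nat_on {..<\<gamma>} \<delta>, N)"
        have "i \<ge> N"
          unfolding i_def by (rule le_prod_encode_2)
        have "\<beta> i = \<delta>"
          using 1 \<open>\<delta> < a\<close> countable_lessThan_countable_ordinal by (simp add: \<beta>_def i_def)
        moreover have "dist c (x i) < e"
          using near[OF G(5)[of i]] N[OF \<open>i \<ge> N\<close>] by simp
        moreover have "x i \<noteq> c"
          using q[of i] by (simp add: x_def)
        moreover have "(x i, \<beta> i) \<in> H"
          using G(5) unfolding H_def by blast
        ultimately show ?thesis
          using 1 by (intro exI[of _ "x i"] exI[of _ "\<beta> i"]) auto
      next
        case 2
        then obtain w b where "(w, b) \<in> G i" "w \<in> ball z e - {z}" "\<delta> \<le> b"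
          using G(3)[of i] \<open>\<delta> < a\<close> \<open>e > 0\<close> unfolding attained_ranks_def by blast
        then show ?thesis
          unfolding H_def by blast
      qed
    qed
    moreover have "countable H"
      unfolding H_def using G(1) by auto
    moreover have "fst ` H \<subseteq> cball c r"
    proof -
      have "dist c z \<le> r" if "(z, a) \<in> G i" for z a i
        using near[OF that] less.prems order_trans[of "dist c z" "r / 2 ^ i" r]
        by (simp add: divide_le_eq)
      then show ?thesis
        using less.prems unfolding H_def by auto
    qed
    moreover have "\<forall>(z, a)\<in>H. a \<le> \<gamma> \<and> (a = \<gamma> \<longrightarrow> z = c)"
      using G\<gamma> unfolding H_def by (auto dest: order_less_imp_le)
    ultimately show ?thesis
      unfolding top_ranked_def H_def by blast
  qed
qed

text \<open>Take \<open>m\<close> top-ranked pieces with distinct centres. They may overlap: unions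
  preserve both rank conditions, and rank \<gamma> occurs in each piece only at its centre. The
  final equivalence later forces \<open>m\<close> to be positive whenever a degenerate limit of
  nonempty clusters arises.\<close>

lemma exists_ranks_card:
  fixes \<gamma> :: countable_ordinal and c :: complex
  assumes "r > 0"
  shows "\<exists>G. countable G \<and> scattered_ranks G \<and> attained_ranks G \<and> fst ` G \<subseteq> cball c r \<and>
    (\<forall>(z, a)\<in>G. a \<le> \<gamma>) \<and> finite {z. (z, \<gamma>) \<in> G} \<and> card {z. (z, \<gamma>) \<in> G} = m \<and>
    (G = {} \<longleftrightarrow> m = 0)"
proof -
  define q where "q i = r / (2 * (real i + 1))" for i
  have q: "0 < q i" "q i \<le> r / 2" for i
    using assms by (auto simp: q_def field_simps)
  define x where "x i = c + of_real (q i)" for i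
  have "\<forall>i. \<exists>G. top_ranked \<gamma> (x i) (r / 2) G"
    using exists_ranks_top[of "r / 2"] assms by simp
  then obtain G where "\<forall>i. top_ranked \<gamma> (x i) (r / 2) (G i)"
    by (rule choice[THEN exE])
  then have G: "\<And>i. countable (G i)" "\<And>i. scattered_ranks (G i)"
    "\<And>i. attained_ranks (G i)" "\<And>i. fst ` G i \<subseteq> cball (x i) (r / 2)" "\<And>i. (x i, \<gamma>) \<in> G i"
    "\<And>i. \<forall>(z, a)\<in>G i. a \<le> \<gamma> \<and> (a = \<gamma> \<longrightarrow> z = x i)"
    unfolding top_ranked_def by blast+
  have "dist c (x i) \<le> r / 2" for i
    using q[of i] by (simp add: x_def dist_norm)
  then have "cball (x i) (r / 2) \<subseteq> cball c r" for i
    by (intro subsetI) (smt (verit) dist_triangle mem_cball field_sum_of_halves)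
  then have sub: "fst ` G i \<subseteq> cball c r" for i
    using G(4) by blast
  have "inj x"
    using assms by (auto simp: inj_def x_def q_def field_simps)
  then have card: "card (x ` {..<m}) = m"
    by (subst card_image) (auto intro: inj_on_subset)
  have eq: "{z. (z, \<gamma>) \<in> (\<Union>i<m. G i)} = x ` {..<m}"
  proof (intro equalityI subsetI)
    fix z assume "z \<in> {z. (z, \<gamma>) \<in> (\<Union>i<m. G i)}"
    then obtain i where "i < m" "(z, \<gamma>) \<in> G i"
      by blast
    then show "z \<in> x ` {..<m}"
      using G(6)[of i] by auto
  qed (use G(5) in blast)
  show ?thesis
  proof (intro exI[of _ "\<Union>i<m. G i"] conjI)
    have "G i \<noteq> {}" for i
      using G(5) by blast
    then show "((\<Union>i<m. G i) = {}) = (m = 0)"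
      by auto
    show "\<forall>(z, a)\<in>(\<Union>i<m. G i). a \<le> \<gamma>"
      using G(6) by fastforce
    show "fst ` (\<Union>i<m. G i) \<subseteq> cball c r"
      using sub by blast
  qed (use G(1-3) card eq in \<open>auto intro!: scattered_ranks_UN attained_ranks_UN\<close>)
qed

section \<open>Convergence to infinity\<close>

lemma dist_Finite_Infinity:
  "dist (Finite w) Infinity = arccos (((cmod w)\<^sup>2 - 1) / ((cmod w)\<^sup>2 + 1))"
  by (simp add: dist_riemann_sphere_def)

lemma dist_Infinity_ge:
  assumes "cmod w \<le> 1"
  shows "dist (Finite w) Infinity \<ge> pi / 2"
proof -
  have w: "(cmod w)\<^sup>2 \<le> 1" "(cmod w)\<^sup>2 \<ge> 0"
    using assms by (auto simp: power_le_one)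
  then have "arccos 0 \<le> arccos (((cmod w)\<^sup>2 - 1) / ((cmod w)\<^sup>2 + 1))"
    by (intro arccos_le_arccos divide_nonpos_nonneg) (auto simp: pos_le_divide_eq add_nonneg_pos)
  then show ?thesis
    by (simp add: dist_Finite_Infinity)
qed

lemma dist_Infinity_less:
  assumes "\<epsilon> > 0"
  shows "\<exists>M. \<forall>w. cmod w \<ge> M \<longrightarrow> dist (Finite w) Infinity < \<epsilon>"
proof -
  define h :: "real \<Rightarrow> real" where "h x = (x\<^sup>2 - 1) / (x\<^sup>2 + 1)" for x
  have pos: "x\<^sup>2 + 1 > 0" for x :: real
    by (smt (verit) zero_le_power2)
  have "(h \<longlongrightarrow> 1) at_top"
    unfolding h_def by real_asymp
  moreover have "h x \<in> {-1..1}" for x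
    using pos[of x] by (auto simp: h_def field_simps)
  ultimately have "((\<lambda>x. arccos (h x)) \<longlongrightarrow> arccos 1) at_top"
    by (intro continuous_on_tendsto_compose[OF continuous_on_arccos']) auto
  then have "\<forall>\<^sub>F x in at_top. arccos (h x) < \<epsilon>"
    using assms by (intro order_tendstoD(2)) auto
  then show ?thesis
    unfolding eventually_at_top_linorder dist_Finite_Infinity h_def by blast
qed

lemma sphere_val_eq_Finite:
  assumes "f holomorphic_on UNIV"
  shows "sphere_val f z = Finite (f z)"
proof -
  have "\<not> is_pole f z"
    using assms by (intro not_is_pole_holomorphic[of UNIV]) auto
  then show ?thesis
    by (simp add: sphere_val_def)
qed

text \<open>A uniform limit near \<open>z0\<close> would be infinite off \<open>Z\<close>, and every
  disk has points off \<open>Z\<close> since it is uncountable. But a single late member vanishes at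
  \<open>z0\<close>, so near \<open>z0\<close> it has modulus at most 1 and spherical distance at
  least pi/2 from infinity.\<close>

lemma not_C0_point_if_zero:
  assumes hol: "\<And>i. S i holomorphic_on UNIV"
    and zero: "\<forall>\<^sub>F i in sequentially. S i z0 = 0"
    and "countable Z"
    and lim: "\<And>z. z \<in> D - Z \<Longrightarrow> (\<lambda>i. sphere_val (S i) z) \<longlonglongrightarrow> Infinity"
  shows "\<not> C0_point D S z0"
proof
  assume "C0_point D S z0"
  then obtain r g where r: "r > 0" "ball z0 r \<subseteq> D"
    and g: "uniform_limit (ball z0 r) (\<lambda>n. sphere_val (S n)) g sequentially"
    unfolding C0_point_def by blast
  have "\<forall>\<^sub>F i in sequentially. \<forall>z\<in>ball z0 r. dist (sphere_val (S i) z) (g z) < 1"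
    using g by (rule uniform_limitD) simp
  then have "\<forall>\<^sub>F i in sequentially. S i z0 = 0 \<and>
      (\<forall>z\<in>ball z0 r. dist (sphere_val (S i) z) (g z) < 1)"
    using zero by (simp add: eventually_conj_iff)
  then obtain i where i: "S i z0 = 0" "\<And>z. z \<in> ball z0 r \<Longrightarrow> dist (sphere_val (S i) z) (g z) < 1"
    using eventually_happens'[OF sequentially_bot] by blast
  \<comment> \<open>The index \<open>i\<close> is fixed before the radius \<open>e\<close>, since
    only continuity of this one function is available.\<close>
  have "isCont (S i) z0"
    using hol[of i] holomorphic_on_imp_continuous_on continuous_on_interior[of UNIV "S i" z0] by simp
  then obtain e where e: "e > 0" "\<And>z. dist z z0 < e \<Longrightarrow> dist (S i z) (S i z0) < 1"
    unfolding continuous_at_eps_delta by (meson zero_less_one)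
  have "uncountable (ball z0 (min r e))"
    using r(1) e(1) by (intro uncountable_ball) auto
  then obtain z where z: "z \<in> ball z0 (min r e)" "z \<notin> Z"
    using countable_subset[OF _ \<open>countable Z\<close>, of "ball z0 (min r e)"] by (meson subsetI)
  have "(\<lambda>n. sphere_val (S n) z) \<longlonglongrightarrow> g z"
    using z(1) by (intro tendsto_uniform_limitI[OF g]) auto
  moreover have "(\<lambda>n. sphere_val (S n) z) \<longlonglongrightarrow> Infinity"
    using z r(2) by (intro lim) auto
  ultimately have "g z = Infinity"
    using LIMSEQ_unique by blast
  then have "dist (Finite (S i z)) Infinity < 1"
    using i(2)[of z] z(1) by (simp add: sphere_val_eq_Finite[OF hol])
  moreover have "cmod (S i z) \<le> 1"
    using e(2)[of z] z(1) i(1) by (simp add: dist_commute)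
  ultimately show False
    using dist_Infinity_ge[of "S i z"] pi_ge_two by simp
qed


section \<open>An entire function with prescribed clusters of zeros\<close>

text \<open>The quadratic exponent makes \<open>scale k * q ^ k\<close> tend to infinity for every
  fixed \<open>q > 0\<close>, which absorbs the loss from up to \<open>k\<close> factors, each
  bounded below by a constant.\<close>

definition scale :: "nat \<Rightarrow> real" where
  "scale m = 4 ^ (m\<^sup>2)"

lemma scale_pos [simp]: "scale m > 0"
  by (simp add: scale_def)

lemma scale_nonneg [simp]: "scale m \<ge> 0"
  by (simp add: less_imp_le)

lemma scale_mono: "m \<le> n \<Longrightarrow> scale m \<le> scale n"
  unfolding scale_def by (intro power_increasing power_mono) auto

lemma scale_Suc: "scale (Suc m) = 4 ^ (2 * m + 1) * scale m"
  unfolding scale_def by (simp add: power_add[symmetric] power2_eq_square)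

lemma norm_prod_minus_1_le:
  fixes x :: "'a \<Rightarrow> complex"
  assumes "finite A"
  shows "norm ((\<Prod>e\<in>A. 1 + x e) - 1) \<le> exp (\<Sum>e\<in>A. norm (x e)) - 1"
  using assms
proof (induction A)
  case (insert e A)
  define p where "p = (\<Prod>e\<in>A. 1 + x e)"
  define s where "s = (\<Sum>e\<in>A. norm (x e))"
  have "norm (p - 1) \<le> exp s - 1"
    using insert unfolding p_def s_def by blast
  moreover have "norm p \<le> norm (p - 1) + 1"
    using norm_triangle_ineq[of "p - 1" 1] by simp
  ultimately have p: "norm (p - 1) \<le> exp s - 1" "norm p \<le> exp s"
    by auto
  have "(1 + x e) * p - 1 = (p - 1) + x e * p"
    by (simp add: algebra_simps)
  then have "norm ((1 + x e) * p - 1) \<le> norm (p - 1) + norm (x e) * norm p"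
    using norm_triangle_ineq[of "p - 1" "x e * p"] by (simp only: norm_mult)
  also have "\<dots> \<le> (exp s - 1) + norm (x e) * exp s"
    using p by (intro add_mono mult_left_mono) auto
  also have "\<dots> = (1 + norm (x e)) * exp s - 1"
    by (simp add: algebra_simps)
  also have "\<dots> \<le> exp (norm (x e)) * exp s - 1"
    by (intro diff_right_mono mult_right_mono exp_ge_add_one_self) auto
  finally show ?case
    using insert by (simp add: p_def s_def exp_add)
qed simp

text \<open>The bound on the cardinality limits a cluster to \<open>m\<close> factors; the disk
  about 1 keeps its zeros at modulus comparable with \<open>scale m\<close> after scaling.\<close>

locale zero_clusters =
  fixes E :: "nat \<Rightarrow> complex set"
  assumes finite_E: "finite (E m)"
    and card_E: "card (E m) \<le> m"
    and E_subset: "E m \<subseteq> cball 1 (1 / 2)"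
begin

lemma norm_E:
  assumes "e \<in> E m"
  shows "1 / 2 \<le> norm e" "norm e \<le> 3 / 2"
proof -
  have "norm (1 - e) \<le> 1 / 2"
    using assms E_subset[of m] by (auto simp: dist_norm)
  then show "1 / 2 \<le> norm e" "norm e \<le> 3 / 2"
    using norm_triangle_ineq2[of 1 e] norm_triangle_ineq2[of e 1] by (auto simp: norm_minus_commute)
qed

definition cluster :: "nat \<Rightarrow> complex \<Rightarrow> complex" where
  "cluster m z = (\<Prod>e\<in>E m. 1 - z / (of_real (scale m) * e))"

lemma norm_term_le:
  assumes "e \<in> E m"
  shows "norm (z / (of_real (scale m) * e)) \<le> 2 * norm z / scale m"
proof -
  have "norm (z / (of_real (scale m) * e)) = norm z / scale m * (1 / norm e)"
    by (simp add: norm_divide norm_mult less_imp_le)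
  also have "\<dots> \<le> norm z / scale m * 2"
    using norm_E[OF assms] by (intro mult_left_mono) (auto simp: divide_le_eq)
  finally show ?thesis
    by (simp add: mult.commute)
qed

lemma norm_cluster_minus_1_le: "norm (cluster m z - 1) \<le> exp (2 * real m * norm z / scale m) - 1"
proof -
  have "norm (cluster m z - 1) \<le> exp (\<Sum>e\<in>E m. norm (- (z / (of_real (scale m) * e)))) - 1"
    using norm_prod_minus_1_le[OF finite_E, of "\<lambda>e. - (z / (of_real (scale m) * e))" m]
    by (simp add: cluster_def)
  also have "(\<Sum>e\<in>E m. norm (- (z / (of_real (scale m) * e)))) \<le> card (E m) * (2 * norm z / scale m)"
    using norm_term_le by (intro sum_bounded_above) auto
  also have "\<dots> \<le> m * (2 * norm z / scale m)"
    using card_E[of m] by (intro mult_right_mono) (auto simp: less_imp_le)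
  finally show ?thesis
    by (simp add: mult_ac)
qed

definition cluster_prod :: "complex \<Rightarrow> complex" where
  "cluster_prod z = lim (\<lambda>M. \<Prod>m<M. cluster m z)"

text \<open>The factor \<open>z\<close> gives every dilation a zero at the origin. It also supplies
  the growth: at the scale of cluster \<open>k\<close> it contributes a factor of order
  \<open>scale k\<close>, against lower bounds of the form \<open>q ^ k\<close> for the
  clusters.\<close>

definition cluster_fun :: "complex \<Rightarrow> complex" where
  "cluster_fun z = z * cluster_prod z"

text \<open>The Weierstrass criterion applies: on a disk of radius \<open>C\<close> the deviation of
  a cluster from 1 is at most \<open>exp (2 * m * C / scale m) - 1\<close>, which is summable
  because the scales outgrow every power of \<open>m\<close>.\<close>

lemma uniform_limit_cluster_prod:
  "uniform_limit (cball (0 :: complex) C) (\<lambda>M z. \<Prod>m<M. cluster m z) cluster_prod sequentially"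
proof -
  have "uniformly_convergent_on (cball (0 :: complex) C) (\<lambda>M z. \<Prod>m<M. cluster m z)"
  proof (rule uniformly_convergent_on_prod')
    show "continuous_on (cball 0 C) (cluster m)" for m
    proof -
      have "e \<noteq> 0" if "e \<in> E m" for e
        using norm_E[OF that] by auto
      then show ?thesis
        unfolding cluster_def using less_imp_neq[OF scale_pos[of m]]
        by (intro continuous_intros) auto
    qed
    have "(\<lambda>m. exp (2 * real m * C / scale m) - 1) \<in> O(\<lambda>m. 1 / real m ^ 2)"
      unfolding scale_def by real_asymp
    moreover have "summable (\<lambda>m. norm (1 / real m ^ 2))"
      using inverse_power_summable[of 2, where 'a = real] by (simp add: field_simps)
    ultimately have "summable (\<lambda>m. exp (2 * real m * C / scale m) - 1)"
      by (rule summable_comparison_test_bigo[rotated])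
    then show "uniformly_convergent_on (cball (0 :: complex) C) (\<lambda>N z. \<Sum>n<N. norm (cluster n z - 1))"
    proof (rule Weierstrass_m_test'[rotated])
      fix m and z :: complex assume "z \<in> cball 0 C"
      then have "2 * real m * norm z / scale m \<le> 2 * real m * C / scale m"
        by (intro divide_right_mono mult_left_mono) auto
      then have "exp (2 * real m * norm z / scale m) \<le> exp (2 * real m * C / scale m)"
        by simp
      then show "norm (norm (cluster m z - 1)) \<le> exp (2 * real m * C / scale m) - 1"
        using norm_cluster_minus_1_le[of m z] by (simp only: real_norm_def abs_norm_cancel)
    qed
  qed auto
  then show ?thesis
    unfolding uniformly_convergent_uniform_limit_iff cluster_prod_def .
qed

lemma tendsto_cluster_prod: "(\<lambda>M. \<Prod>m<M. cluster m z) \<longlonglongrightarrow> cluster_prod z"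
  by (rule tendsto_uniform_limitI[OF uniform_limit_cluster_prod[of "norm z"]]) simp

lemma holomorphic_cluster_fun: "cluster_fun holomorphic_on UNIV"
proof -
  have "cluster_prod holomorphic_on UNIV"
  proof (rule holomorphic_uniform_sequence)
    show "(\<lambda>z. \<Prod>m<M. cluster m z) holomorphic_on UNIV" for M
    proof -
      have "e \<noteq> 0" if "e \<in> E m" for e m
        using norm_E[OF that] by auto
      then show ?thesis
        unfolding cluster_def using less_imp_neq[OF scale_pos]
        by (intro holomorphic_intros) auto
    qed
    fix z :: complex
    have "cball z 1 \<subseteq> cball 0 (norm z + 1)"
      by (auto simp: dist_norm) (smt (verit) norm_minus_commute norm_triangle_sub)
    then have "uniform_limit (cball z 1) (\<lambda>M z. \<Prod>m<M. cluster m z) cluster_prod sequentially"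
      using uniform_limit_on_subset[OF uniform_limit_cluster_prod] by blast
    then show "\<exists>d>0. cball z d \<subseteq> UNIV \<and>
        uniform_limit (cball z d) (\<lambda>M z. \<Prod>m<M. cluster m z) cluster_prod sequentially"
      by (intro exI[of _ 1]) auto
  qed auto
  then show ?thesis
    unfolding cluster_fun_def by (intro holomorphic_intros)
qed

lemma cluster_fun_0 [simp]: "cluster_fun 0 = 0"
  by (simp add: cluster_fun_def)

lemma cluster_fun_zero:
  assumes "e \<in> E m"
  shows "cluster_fun (of_real (scale m) * e) = 0"
proof -
  have "e \<noteq> 0"
    using norm_E[OF assms] by auto
  then have "cluster m (of_real (scale m) * e) = 0"
    unfolding cluster_def using assms finite_E less_imp_neq[OF scale_pos[of m]]
    by (intro prod_zero) (auto intro!: bexI[of _ e])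
  then have "(\<Prod>i<M. cluster i (of_real (scale m) * e)) = 0" if "M > m" for M
    using that by (intro prod_zero) auto
  then have "\<forall>\<^sub>F M in sequentially. (\<Prod>i<M. cluster i (of_real (scale m) * e)) = 0"
    using eventually_gt_at_top[of m] by (rule eventually_mono[rotated])
  then have "(\<lambda>M. \<Prod>i<M. cluster i (of_real (scale m) * e)) \<longlonglongrightarrow> 0"
    by (rule tendsto_eventually)
  then have "cluster_prod (of_real (scale m) * e) = 0"
    using tendsto_cluster_prod LIMSEQ_unique by blast
  then show ?thesis
    by (simp add: cluster_fun_def)
qed

section \<open>Lower bounds for the clusters and their product\<close>

lemma norm_cluster_eq: "norm (cluster m z) = (\<Prod>e\<in>E m. norm (1 - z / (of_real (scale m) * e)))"
  by (simp add: cluster_def prod_norm)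

lemma norm_cluster_ge_power:
  assumes "0 \<le> q" "q \<le> 1" "\<And>e. e \<in> E m \<Longrightarrow> q \<le> norm (1 - z / (of_real (scale m) * e))"
  shows "q ^ m \<le> norm (cluster m z)"
proof -
  have "q ^ m \<le> q ^ card (E m)"
    using assms card_E by (intro power_decreasing) auto
  also have "\<dots> = (\<Prod>e\<in>E m. q)"
    by simp
  also have "\<dots> \<le> norm (cluster m z)"
    unfolding norm_cluster_eq using assms by (intro prod_mono) auto
  finally show ?thesis .
qed

lemma norm_cluster_ge_outer:
  assumes "2 * norm z \<le> q * scale m" "0 \<le> q" "q \<le> 1"
  shows "(1 - q) ^ m \<le> norm (cluster m z)"
proof (rule norm_cluster_ge_power)
  fix e assume "e \<in> E m"
  then have "norm (z / (of_real (scale m) * e)) \<le> 2 * norm z / scale m"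
    by (rule norm_term_le)
  also have "\<dots> \<le> q"
    using assms by (simp add: divide_le_eq)
  finally show "1 - q \<le> norm (1 - z / (of_real (scale m) * e))"
    using norm_triangle_ineq2[of 1 "z / (of_real (scale m) * e)"] by simp
qed (use assms in auto)

text \<open>The zeros have modulus at most \<open>2 * scale m\<close>, so a distance of
  \<open>\<delta> * scale m\<close> from each of them makes every factor at least
  \<open>\<delta> / 2\<close>.\<close>

lemma norm_cluster_ge_near:
  assumes "\<And>e. e \<in> E m \<Longrightarrow> \<delta> * scale m \<le> norm (z - of_real (scale m) * e)" "0 \<le> \<delta>" "\<delta> \<le> 1"
  shows "(\<delta> / 2) ^ m \<le> norm (cluster m z)"
proof (rule norm_cluster_ge_power)
  fix e assume e: "e \<in> E m"
  have "e \<noteq> 0"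
    using norm_E[OF e] by auto
  have "1 - z / (of_real (scale m) * e) = - ((z - of_real (scale m) * e) / (of_real (scale m) * e))"
    using \<open>e \<noteq> 0\<close> less_imp_neq[OF scale_pos[of m]] by (simp add: field_simps)
  then have eq: "norm (1 - z / (of_real (scale m) * e)) = norm (z - of_real (scale m) * e) / (scale m * norm e)"
    by (simp only: norm_minus_cancel norm_divide norm_mult norm_of_real) (simp add: less_imp_le)
  have "\<delta> / 2 * (scale m * norm e) \<le> \<delta> / 2 * (scale m * 2)"
    using norm_E[OF e] assms by (intro mult_left_mono) (auto simp: less_imp_le)
  also have "\<dots> \<le> norm (z - of_real (scale m) * e)"
    using assms(1)[OF e] by simp
  finally show "\<delta> / 2 \<le> norm (1 - z / (of_real (scale m) * e))"
    unfolding eq using \<open>e \<noteq> 0\<close> by (simp add: le_divide_eq)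
qed (use assms in auto)

text \<open>Zeros of cluster \<open>m\<close> have modulus at most \<open>3 / 2 * scale m\<close>,
  so each quotient has modulus at least 2 and each factor at least 1.\<close>

lemma norm_cluster_ge_1:
  assumes "3 * scale m \<le> norm z"
  shows "1 \<le> norm (cluster m z)"
proof -
  have "1 ^ m \<le> norm (cluster m z)"
  proof (rule norm_cluster_ge_power)
    fix e assume e: "e \<in> E m"
    have "e \<noteq> 0"
      using norm_E[OF e] by auto
    have "2 * (scale m * norm e) \<le> 2 * (scale m * (3 / 2))"
      using norm_E[OF e] by (intro mult_left_mono) (auto simp: less_imp_le)
    also have "\<dots> \<le> norm z"
      using assms by simp
    finally have "2 \<le> norm (z / (of_real (scale m) * e))"
      using \<open>e \<noteq> 0\<close> by (simp add: norm_divide norm_mult le_divide_eq less_imp_le)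
    then show "1 \<le> norm (1 - z / (of_real (scale m) * e))"
      using norm_triangle_ineq2[of "z / (of_real (scale m) * e)" 1] by (simp add: norm_minus_commute)
  qed auto
  then show ?thesis
    by simp
qed

text \<open>From \<open>m = k + 2\<close> on, \<open>norm z\<close> is so small against
  \<open>scale m\<close> that cluster \<open>m\<close> has modulus at least
  \<open>1 - (1 / 2) ^ m\<close>. These defects sum to at most 1/2, and the product is at least 1
  minus their sum.\<close>

lemma prod_norm_cluster_tail_ge:
  assumes "2 * norm z \<le> scale (k + 1)"
  shows "1 / 2 \<le> (\<Prod>m=k+2..<M. norm (cluster m z))"
proof -
  have half: "1 - (1 / 2) ^ m \<le> norm (cluster m z)" if m: "m \<ge> k + 2" for m
  proof -
    define q :: real where "q = (1 / 4) ^ m"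
    \<comment> \<open>The exponents of \<open>scale (k + 1)\<close> and \<open>scale m\<close>
      differ by at least \<open>2 * m - 1\<close>, hence by at least \<open>m\<close>.\<close>
    have "(k + 1)\<^sup>2 \<le> (m - 1)\<^sup>2"
      using m by (intro power_mono) auto
    moreover have "m\<^sup>2 = (m - 1)\<^sup>2 + (2 * m - 1)"
      using m by (cases m) (auto simp: power2_eq_square)
    ultimately have "(k + 1)\<^sup>2 + m \<le> m\<^sup>2"
      using m by linarith
    then have "scale (k + 1) * 4 ^ m \<le> scale m"
      unfolding scale_def power_add[symmetric] by (intro power_increasing) auto
    then have "scale (k + 1) \<le> q * scale m"
      by (simp add: q_def power_one_over field_simps)
    with assms have "2 * norm z \<le> q * scale m"
      by (rule order_trans)
    then have "(1 - q) ^ m \<le> norm (cluster m z)"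
      by (rule norm_cluster_ge_outer) (auto simp: q_def power_le_one)
    moreover have "1 - real m * q \<le> (1 - q) ^ m"
      using Bernoulli_inequality[of "- q" m] by (simp add: q_def power_le_one)
    moreover have "real m * q \<le> (1 / 2) ^ m"
    proof -
      have "real m * q \<le> 2 ^ m * q"
        using of_nat_less_two_power[of m, where 'a = real] by (intro mult_right_mono) (auto simp: q_def)
      also have "\<dots> = (1 / 2) ^ m"
        by (simp add: q_def power_mult_distrib[symmetric])
      finally show ?thesis .
    qed
    ultimately show ?thesis
      by linarith
  qed
  have "(\<Sum>m=k+2..<M. (1 / 2 :: real) ^ m) \<le> (\<Sum>m=2..<M+2. (1 / 2) ^ m)"
    by (intro sum_mono2) auto
  also have "\<dots> = 1 / 2 - (1 / 2) ^ (M + 1)"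
    by (induction M) (auto simp: power2_eq_square)
  also have "\<dots> \<le> 1 / 2"
    by simp
  finally have "1 / 2 \<le> 1 - (\<Sum>m=k+2..<M. (1 / 2 :: real) ^ m)"
    by simp
  also have "\<dots> \<le> (\<Prod>m=k+2..<M. 1 - (1 / 2) ^ m)"
    by (intro Weierstrass_prod_ineq) (auto simp: power_le_one)
  also have "\<dots> \<le> (\<Prod>m=k+2..<M. norm (cluster m z))"
    using half by (intro prod_mono) (auto simp: power_le_one)
  finally show ?thesis .
qed

text \<open>The product splits into clusters before \<open>k\<close>, which have modulus at least 1,
  clusters \<open>k\<close> and \<open>k + 1\<close>, and a tail of modulus at least 1/2. Cluster
  \<open>k + 1\<close> is treated apart because \<open>z\<close> may be comparable with its scale;
  the factor \<open>1 - r\<close> measures the remaining gap.\<close>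

lemma norm_cluster_fun_ge:
  assumes inner: "\<And>m. m < k \<Longrightarrow> 3 * scale m \<le> norm z"
    and near: "\<And>e. e \<in> E k \<Longrightarrow> \<delta> * scale k \<le> norm (z - of_real (scale k) * e)"
    and outer: "2 * norm z \<le> r * scale (k + 1)"
    and "0 \<le> \<delta>" "\<delta> \<le> 1" "0 \<le> r" "r \<le> 1"
  shows "norm z * ((\<delta> / 2) ^ k * (1 - r) ^ (k + 1) / 2) \<le> norm (cluster_fun z)"
proof -
  define B where "B = (\<delta> / 2) ^ k * (1 - r) ^ (k + 1) / 2"
  have B: "B \<le> norm (\<Prod>m<M. cluster m z)" if M: "M \<ge> k + 2" for M
  proof -
    have "{..<M} = {..<k} \<union> ({k, k + 1} \<union> {k+2..<M})"
      using M by auto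
    moreover have "prod g ({..<k} \<union> ({k, k + 1} \<union> {k+2..<M})) =
        prod g {..<k} * (g k * g (k + 1)) * prod g {k+2..<M}" for g :: "nat \<Rightarrow> real"
      by (subst prod.union_disjoint, simp, simp, fastforce)+ (simp add: mult.assoc)
    ultimately have "norm (\<Prod>m<M. cluster m z) = (\<Prod>m<k. norm (cluster m z)) *
        (norm (cluster k z) * norm (cluster (k + 1) z)) * (\<Prod>m=k+2..<M. norm (cluster m z))"
      by (simp only: prod_norm[symmetric])
    moreover have "1 \<le> (\<Prod>m<k. norm (cluster m z))"
      using norm_cluster_ge_1 inner by (intro prod_ge_1) auto
    moreover have "2 * norm z \<le> scale (k + 1)"
      using order_trans[OF outer mult_left_le_one_le] assms by simp
    then have "1 / 2 \<le> (\<Prod>m=k+2..<M. norm (cluster m z))"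
      by (rule prod_norm_cluster_tail_ge)
    moreover have "(\<delta> / 2) ^ k * (1 - r) ^ (k + 1) \<le> norm (cluster k z) * norm (cluster (k + 1) z)"
      using norm_cluster_ge_near[OF near] norm_cluster_ge_outer[OF outer] assms(4-7)
      by (intro mult_mono) auto
    moreover have "1 * B' * (1 / 2) \<le> a * b * c" if "1 \<le> a" "0 \<le> B'" "B' \<le> b" "1 / 2 \<le> c"
      for a b c B' :: real
      using that by (intro mult_mono) auto
    moreover have "0 \<le> (\<delta> / 2) ^ k * (1 - r) ^ (k + 1)"
      using assms(4-7) by simp
    ultimately have "1 * ((\<delta> / 2) ^ k * (1 - r) ^ (k + 1)) * (1 / 2) \<le> norm (\<Prod>m<M. cluster m z)"
      by presburger
    then show ?thesis
      by (simp add: B_def)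
  qed
  have "B \<le> norm (cluster_prod z)"
    using tendsto_norm[OF tendsto_cluster_prod] B
    by (rule tendsto_lowerbound[OF _ eventually_sequentiallyI]) auto
  then show ?thesis
    unfolding cluster_fun_def norm_mult B_def[symmetric] by (intro mult_left_mono) auto
qed

lemma scale_bound_at_top:
  assumes "q > 0" "c > 0"
  shows "filterlim (\<lambda>k. c * (scale k * q ^ k)) at_top sequentially"
proof -
  have "filterlim (\<lambda>k. q * 4 ^ k) at_top sequentially"
    using assms(1) by real_asymp
  then have "\<forall>\<^sub>F k in sequentially. q * 4 ^ k \<ge> 2"
    unfolding filterlim_at_top by blast
  then have "\<forall>\<^sub>F k in sequentially. c * 2 ^ k \<le> c * (scale k * q ^ k)"
  proof eventually_elim
    case (elim k)
    have "scale k * q ^ k = (q * 4 ^ k) ^ k"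
      by (simp add: scale_def power_mult_distrib power_mult power2_eq_square)
    moreover have "2 ^ k \<le> (q * 4 ^ k) ^ k"
      using elim by (intro power_mono) auto
    ultimately show ?case
      using assms(2) by simp
  qed
  moreover have "filterlim (\<lambda>k. c * 2 ^ k) at_top sequentially"
    using assms(2) by real_asymp
  ultimately show ?thesis
    by (rule filterlim_at_top_mono[rotated])
qed

text \<open>After division by \<open>N i\<close> only cluster \<open>ks i\<close> can place zeros in
  the unit disk, and these approach the multiple of \<open>L\<close> by \<open>s\<close>. Away from
  this set and from 0, the lower bound for \<open>cluster_fun\<close> is a constant times
  \<open>scale k * q ^ k\<close>, which tends to infinity.\<close>

lemma uniform_limit_dilations_Infinity:
  fixes N ks :: "nat \<Rightarrow> nat"
  assumes ks: "filterlim ks at_top sequentially"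
    and lower: "\<And>i. scale (ks i) \<le> 2 * real (N i)"
    and upper: "\<And>i. 2 * real (N i) \<le> scale (ks i + 1)"
    and s: "(\<lambda>i. scale (ks i) / N i) \<longlonglongrightarrow> s"
    and L: "compact L" "\<And>\<epsilon>. \<epsilon> > 0 \<Longrightarrow> \<forall>\<^sub>F i in sequentially. \<forall>e\<in>E (ks i). \<exists>l\<in>L. dist e l < \<epsilon>"
    and z0: "norm z0 < 1" "z0 \<noteq> 0" "z0 \<notin> (*) (of_real s) ` L"
  shows "\<exists>d>0. ball z0 d \<subseteq> ball 0 1 \<and> uniform_limit (ball z0 d)
    (\<lambda>i. sphere_val (\<lambda>z. cluster_fun (of_nat (N i) * z))) (\<lambda>_. Infinity) sequentially"
proof -
  have N: "real (N i) > 0" for i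
    using lower[of i] scale_pos[of "ks i"] by linarith
  have s_le: "scale (ks i) / N i \<in> {0..2}" for i
    using lower[of i] N[of i] by (simp add: divide_le_eq)
  have "s \<in> {0..2}"
    using s_le by (intro closed_sequentially[OF closed_real_atLeastAtMost _ s]) blast
  have "closed ((*) (of_real s) ` L)"
    using L(1) by (intro compact_imp_closed compact_continuous_image continuous_intros)
  then have "open (- (*) (of_real s) ` L)"
    by (rule open_Compl)
  with z0(3) obtain d0 where d0: "d0 > 0" "ball z0 d0 \<subseteq> - (*) (of_real s) ` L"
    unfolding open_contains_ball by blast
  \<comment> \<open>The disk of radius \<open>d\<close> about \<open>z0\<close> stays in the annulus
    from \<open>d\<close> to \<open>1 - d\<close>, and \<open>z0\<close> keeps distance
    \<open>4 * d\<close> from the scaled limit set.\<close>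
  define d where "d = min (d0 / 4) (min (norm z0 / 2) ((1 - norm z0) / 2))"
  have "d > 0" "d \<le> d0 / 4" "d \<le> norm z0 / 2" "d \<le> (1 - norm z0) / 2"
    unfolding d_def min_less_iff_conj min_le_iff_disj using d0(1) z0 by auto
  then have d: "d > 0" "4 * d \<le> d0" "2 * d \<le> norm z0" "norm z0 \<le> 1 - 2 * d"
    by auto
  have far: "4 * d \<le> dist z0 (of_real s * l)" if "l \<in> L" for l
  proof -
    have "of_real s * l \<notin> ball z0 d0"
      using d0(2) that by blast
    then show ?thesis
      using d(2) by simp
  qed
  have ball: "norm z \<le> 1 - d" "d \<le> norm z" if "z \<in> ball z0 d" for z
    using that d norm_triangle_ineq2[of z z0] norm_triangle_ineq2[of z0 z]
    by (auto simp: dist_norm norm_minus_commute)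
  \<comment> \<open>The bound is applied with separation \<open>d / 2\<close> and
    \<open>r = 1 - d\<close>, so cluster \<open>k\<close> loses \<open>d / 4\<close> per factor and
    cluster \<open>k + 1\<close> loses \<open>d\<close>.\<close>
  define q where "q = d / 4 * d"
  have "q > 0"
    using d(1) by (simp add: q_def)
  have "\<forall>\<^sub>F i in sequentially. \<forall>e\<in>E (ks i). \<exists>l\<in>L. dist e l < d / 4"
    using d(1) by (intro L(2)) simp
  moreover have "\<forall>\<^sub>F i in sequentially. dist (scale (ks i) / N i) s < d / 4"
    using s d(1) by (intro tendstoD) auto
  \<comment> \<open>This makes three times the preceding scale at most
    \<open>d / 2 * scale (ks i)\<close>, so all earlier clusters lie well inside.\<close>
  moreover have "\<forall>\<^sub>F i in sequentially. 6 / d \<le> 4 ^ ks i"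
  proof -
    have "filterlim (\<lambda>i. 4 ^ ks i :: real) at_top sequentially"
      by (rule filterlim_compose[OF _ ks]) real_asymp
    then show ?thesis
      unfolding filterlim_at_top by blast
  qed
  ultimately have bound: "\<forall>\<^sub>F i in sequentially. \<forall>z\<in>ball z0 d.
      d * d / 4 * (scale (ks i) * q ^ ks i) \<le> norm (cluster_fun (of_nat (N i) * z))"
  proof eventually_elim
    case (elim i)
    define k where "k = ks i"
    show ?case
    proof
      fix z assume z: "z \<in> ball z0 d"
      define w where "w = of_nat (N i) * z"
      have norm_w: "norm w = N i * norm z"
        by (simp add: w_def norm_mult)
      have "scale k / 2 * d \<le> N i * norm z"
        using lower[of i] ball[OF z] d(1) by (intro mult_mono) (auto simp: k_def)
      then have w_ge: "d / 2 * scale k \<le> norm w"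
        by (simp add: norm_w mult_ac)
      have le: "norm w * ((d / 2 / 2) ^ k * (1 - (1 - d)) ^ (k + 1) / 2) \<le> norm (cluster_fun w)"
      proof (rule norm_cluster_fun_ge)
        fix m assume "m < k"
        then have "3 * scale m \<le> 3 * scale (k - 1)"
          using scale_mono[of m "k - 1"] by simp
        also have "\<dots> \<le> d / 2 * scale k"
        proof -
          obtain j where j: "k = Suc j"
            using \<open>m < k\<close> by (cases k) auto
          have "6 / d * scale j \<le> 4 ^ k * scale j"
            using elim(3) by (intro mult_right_mono) (auto simp: k_def)
          also have "\<dots> \<le> 4 ^ (2 * j + 1) * scale j"
            unfolding j by (intro mult_right_mono power_increasing) auto
          also have "\<dots> = scale k"
            unfolding j by (rule scale_Suc[symmetric])
          finally show ?thesis
            using d(1) by (simp add: j field_simps)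
        qed
        finally show "3 * scale m \<le> norm w"
          using w_ge by linarith
      next
        fix e assume e: "e \<in> E k"
        then obtain l where l: "l \<in> L" "dist e l < d / 4"
          using elim(1) unfolding k_def by blast
        define si where "si = scale k / N i"
        have si: "si \<in> {0..2}" "\<bar>si - s\<bar> < d / 4"
          using s_le[of i] elim(2) by (auto simp: si_def k_def dist_real_def)
        \<comment> \<open>Both the change of point and the change of ratio cost at most
          \<open>d / 2\<close>, as \<open>s\<close> and \<open>norm e\<close> are at most 2. With
          the move of less than \<open>d\<close> from \<open>z0\<close> to \<open>z\<close>, the gap
          \<open>4 * d\<close> leaves at least \<open>d\<close>.\<close>
        have "of_real s * l - of_real si * e = of_real s * (l - e) + of_real (s - si) * e"
          by (simp add: algebra_simps)
        then have "norm (of_real s * l - of_real si * e) \<le> \<bar>s\<bar> * norm (l - e) + \<bar>s - si\<bar> * norm e"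
          using norm_triangle_ineq[of "of_real s * (l - e)" "of_real (s - si) * e"]
          by (simp only: norm_mult norm_of_real)
        also have "\<dots> \<le> 2 * (d / 4) + d / 4 * 2"
          using \<open>s \<in> {0..2}\<close> l(2) si(2) norm_E[OF e] d(1)
          by (intro add_mono mult_mono) (auto simp: dist_norm norm_minus_commute abs_minus_commute)
        finally have "norm (of_real s * l - of_real si * e) \<le> d"
          by simp
        moreover have "norm (z0 - of_real s * l) \<ge> 4 * d" "norm (z0 - z) < d"
          using far[OF l(1)] z by (auto simp: dist_norm)
        moreover have "z0 - of_real s * l = (z0 - z) + ((z - of_real si * e) - (of_real s * l - of_real si * e))"
          by simp
        then have "norm (z0 - of_real s * l) \<le> norm (z0 - z) +
            (norm (z - of_real si * e) + norm (of_real s * l - of_real si * e))"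
          using norm_triangle_ineq[of "z0 - z" "(z - of_real si * e) - (of_real s * l - of_real si * e)"]
            norm_triangle_ineq4[of "z - of_real si * e" "of_real s * l - of_real si * e"] by simp
        ultimately have "d \<le> norm (z - of_real si * e)"
          using d(1) by linarith
        then have "scale k / 2 * d \<le> N i * norm (z - of_real si * e)"
          using lower[of i] d(1) by (intro mult_mono) (auto simp: k_def)
        also have "\<dots> = norm (of_nat (N i) * (z - of_real si * e))"
          by (simp only: norm_mult norm_of_nat)
        also have "of_nat (N i) * (z - of_real si * e) = w - of_real (scale k) * e"
          using N[of i] by (simp add: w_def si_def algebra_simps)
        finally show "d / 2 * scale k \<le> norm (w - of_real (scale k) * e)"
          by (simp add: mult_ac)
      next
        have "2 * norm w = (2 * N i) * norm z"
          by (simp add: norm_w)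
        also have "\<dots> \<le> scale (k + 1) * (1 - d)"
          using upper[of i] ball[OF z] by (intro mult_mono) (auto simp: k_def)
        finally show "2 * norm w \<le> (1 - d) * scale (k + 1)"
          by (simp add: mult.commute)
      qed (use d norm_ge_zero[of z0] in auto)
      have "q ^ k = (d / 4) ^ k * d ^ k"
        by (simp only: q_def power_mult_distrib)
      then have "d * d / 4 * (scale k * q ^ k) = d / 2 * scale k * ((d / 4) ^ k * d ^ (k + 1) / 2)"
        by simp
      also have "\<dots> \<le> norm w * ((d / 2 / 2) ^ k * (1 - (1 - d)) ^ (k + 1) / 2)"
        using w_ge d(1) by (intro mult_mono) auto
      also note le
      finally show "d * d / 4 * (scale (ks i) * q ^ ks i) \<le> norm (cluster_fun (of_nat (N i) * z))"
        by (simp only: k_def w_def)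
    qed
  qed
  have hol: "(\<lambda>z. cluster_fun (of_nat n * z)) holomorphic_on UNIV" for n
    using holomorphic_on_compose[of "\<lambda>z. of_nat n * z" UNIV cluster_fun]
      holomorphic_on_subset[OF holomorphic_cluster_fun] by (auto simp: o_def intro!: holomorphic_intros)
  have "uniform_limit (ball z0 d) (\<lambda>i. sphere_val (\<lambda>z. cluster_fun (of_nat (N i) * z)))
      (\<lambda>_. Infinity) sequentially"
  proof (rule uniform_limitI)
    fix \<epsilon> :: real assume "\<epsilon> > 0"
    then obtain M where M: "\<And>w. cmod w \<ge> M \<Longrightarrow> dist (Finite w) Infinity < \<epsilon>"
      using dist_Infinity_less by blast
    have "filterlim (\<lambda>i. d * d / 4 * (scale (ks i) * q ^ ks i)) at_top sequentially"
      using scale_bound_at_top[OF \<open>q > 0\<close>, of "d * d / 4"] d(1)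
      by (intro filterlim_compose[OF _ ks]) auto
    then have "\<forall>\<^sub>F i in sequentially. M \<le> d * d / 4 * (scale (ks i) * q ^ ks i)"
      unfolding filterlim_at_top by blast
    with bound show "\<forall>\<^sub>F i in sequentially. \<forall>z\<in>ball z0 d.
        dist (sphere_val (\<lambda>z. cluster_fun (of_nat (N i) * z)) z) Infinity < \<epsilon>"
    proof eventually_elim
      case (elim i)
      then show ?case
        by (metis sphere_val_eq_Finite[OF hol] M order_trans)
    qed
  qed
  moreover have "ball z0 d \<subseteq> ball 0 1"
    using ball d(1) by fastforce
  ultimately show ?thesis
    using d(1) by blast
qed

end

text \<open>If each value is taken only finitely often, then only finitely many indices stay below a
  given bound. The dichotomy is applied both to dilation factors and to cluster types.\<close>

lemma nat_seq_cases:
  fixes t :: "nat \<Rightarrow> nat"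
  obtains j where "infinite {i. t i = j}" | "filterlim t at_top sequentially"
proof (cases "\<exists>j. infinite {i. t i = j}")
  case False
  have "\<forall>\<^sub>F i in sequentially. Z \<le> t i" for Z
  proof -
    have "{i. \<not> Z \<le> t i} = (\<Union>j<Z. {i. t i = j})"
      by auto
    then have "finite {i. \<not> Z \<le> t i}"
      using False by auto
    then show ?thesis
      by (simp add: eventually_cofinite cofinite_eq_sequentially[symmetric])
  qed
  then show ?thesis
    using that(2) unfolding filterlim_at_top by blast
qed (use that in blast)

section \<open>Clusters approximating countable compact sets\<close>

locale cluster_family =
  fixes K :: "nat \<Rightarrow> complex set"
  assumes countable_K: "countable (K j)"
    and closed_K: "closed (K j)"
    and K_subset: "K j \<subseteq> cball 1 (1 / real (j + 2))"
begin

text \<open>Decoding \<open>m\<close> as a pair lets each type occur for infinitely many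
  \<open>m\<close>.\<close>

definition type_of :: "nat \<Rightarrow> nat" where
  "type_of m = fst (prod_decode m)"

text \<open>A finite part of an enumeration of the compact set. The intersection covers the empty
  set, for which \<open>from_nat_into\<close> returns an arbitrary value.\<close>

definition clusters :: "nat \<Rightarrow> complex set" where
  "clusters m = K (type_of m) \<inter> from_nat_into (K (type_of m)) ` {..<m}"

lemma K_subset_half: "K j \<subseteq> cball 1 (1 / 2)"
proof -
  have "1 / real (j + 2) \<le> 1 / 2"
    by (simp add: field_simps)
  then show ?thesis
    using K_subset[of j] by (meson order_trans subset_cball)
qed

lemma compact_K: "compact (K j)"
  using closed_K K_subset_half bounded_subset[OF bounded_cball] compact_eq_bounded_closed by blast

sublocale zero_clusters clusters
proof
  fix m
  show "finite (clusters m)"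
    by (simp add: clusters_def)
  have "card (clusters m) \<le> card (from_nat_into (K (type_of m)) ` {..<m})"
    unfolding clusters_def by (intro card_mono) auto
  also have "\<dots> \<le> m"
    using card_image_le[of "{..<m}"] by simp
  finally show "card (clusters m) \<le> m" .
  show "clusters m \<subseteq> cball 1 (1 / 2)"
    unfolding clusters_def using K_subset_half by blast
qed

section \<open>Sequences of dilations and their exceptional sets\<close>

definition dilation :: "nat \<Rightarrow> complex \<Rightarrow> complex" where
  "dilation n = (\<lambda>z. cluster_fun (of_nat n * z))"

lemma dilation_in_dilations: "n \<ge> 1 \<Longrightarrow> dilation n \<in> dilations cluster_fun"
  by (auto simp: dilations_def dilation_def)

lemma holomorphic_dilation: "dilation n holomorphic_on UNIV"
  unfolding dilation_def
  using holomorphic_on_compose[of "\<lambda>z. of_nat n * z" UNIV cluster_fun]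
    holomorphic_on_subset[OF holomorphic_cluster_fun] by (auto simp: o_def intro!: holomorphic_intros)

text \<open>The scale \<open>scale k\<close> is the last one whose cluster can meet the unit disk after dividing by
  \<open>n\<close>, because clusters have modulus at least \<open>1 / 2\<close>.\<close>

definition level :: "nat \<Rightarrow> nat" where
  "level n = (LEAST k. 2 * real n < scale (k + 1))"

lemma level_upper: "2 * real n < scale (level n + 1)"
proof -
  have "2 * real n < 2 ^ (n + 1)"
    using of_nat_less_two_power[of n, where 'a = real] by simp
  also have "\<dots> \<le> 4 ^ (n + 1)"
    by (intro power_mono) auto
  also have "\<dots> \<le> scale (n + 1)"
    unfolding scale_def by (intro power_increasing) (auto simp: power2_eq_square)
  finally show ?thesis
    unfolding level_def by (rule LeastI)
qed

lemma level_lower: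
  assumes "n \<ge> 1"
  shows "scale (level n) \<le> 2 * real n"
proof (cases "level n")
  case 0
  then show ?thesis
    using assms by (simp add: scale_def)
next
  case (Suc k)
  then have "\<not> 2 * real n < scale (k + 1)"
    unfolding level_def using not_less_Least[of k "\<lambda>k. 2 * real n < scale (k + 1)"] by simp
  then show ?thesis
    using Suc by simp
qed

lemma level_at_top: "filterlim level at_top sequentially"
  unfolding filterlim_at_top
proof
  fix k
  show "\<forall>\<^sub>F n in sequentially. k \<le> level n"
  proof (rule eventually_sequentiallyI)
    fix n assume n: "n \<ge> nat \<lceil>scale k\<rceil>"
    have "scale k \<le> 2 * real n"
      using n scale_pos[of k] by linarith
    then have "scale k < scale (level n + 1)"
      using level_upper[of n] by simp
    then show "k \<le> level n"
      using scale_mono[of "level n + 1" k] by linarith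
  qed
qed

lemma clusters_eventually_near:
  assumes t: "filterlim (\<lambda>i. type_of (ks i)) at_top sequentially" and "\<epsilon> > 0"
  shows "\<forall>\<^sub>F i in sequentially. \<forall>e\<in>clusters (ks i). dist e 1 < \<epsilon>"
proof -
  have "(\<lambda>j. 1 / real (j + 2)) \<longlonglongrightarrow> 0"
    by real_asymp
  then have "\<forall>\<^sub>F j in sequentially. 1 / real (j + 2) < \<epsilon>"
    using \<open>\<epsilon> > 0\<close> by (intro order_tendstoD(2))
  then have "\<forall>\<^sub>F i in sequentially. 1 / real (type_of (ks i) + 2) < \<epsilon>"
    using t by (rule eventually_compose_filterlim)
  then show ?thesis
  proof eventually_elim
    case (elim i)
    show ?case
    proof
      fix e assume "e \<in> clusters (ks i)"
      then have "dist 1 e \<le> 1 / real (type_of (ks i) + 2)"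
        using K_subset[of "type_of (ks i)"] by (auto simp: clusters_def)
      then show "dist e 1 < \<epsilon>"
        using elim by (simp add: dist_commute)
    qed
  qed
qed

text \<open>Either one dilation recurs, or the factors tend to infinity. In the latter case,
  compactness of [0, 2] gives a limit \<open>s\<close> of \<open>scale (level n) / n\<close>, and
  the types either repeat a value \<open>j\<close> or tend to infinity, where the clusters shrink to
  1. Nonemptiness of some \<open>K j\<close> is recorded with the limit {1} so that no exceptional
  point is counted when there are no clusters at all.\<close>

lemma dilations_subsequence:
  fixes S :: "nat \<Rightarrow> complex \<Rightarrow> complex"
  assumes S: "range S \<subseteq> dilations cluster_fun"
  shows "\<exists>(\<kappa> :: nat \<Rightarrow> nat) s L. strict_mono \<kappa> \<and> s \<ge> 0 \<and> ((\<exists>j. L = K j) \<or> L = {1} \<and> (\<exists>j. K j \<noteq> {})) \<and>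
    (\<forall>z\<in>ball 0 1. z \<noteq> 0 \<longrightarrow> z \<notin> (*) (of_real s) ` L \<longrightarrow> C0_point (ball 0 1) (S \<circ> \<kappa>) z)"
proof -
  have "\<forall>i. \<exists>n. n \<ge> 1 \<and> S i = dilation n"
    using S by (fastforce simp: dilations_def dilation_def)
  then obtain N where N: "\<And>i. N i \<ge> 1" "\<And>i. S i = dilation (N i)"
    using choice by metis
  consider n where "infinite {i. N i = n}" | "filterlim N at_top sequentially"
    using nat_seq_cases[of N] by blast
  then show ?thesis
  proof cases
    case (1 n)
    obtain \<kappa> :: "nat \<Rightarrow> nat" where "strict_mono \<kappa>" "\<forall>i. \<kappa> i \<in> {i. N i = n}"
      using infinite_enumerate[OF 1] by blast
    then have \<kappa>: "strict_mono \<kappa>" "\<And>i. N (\<kappa> i) = n"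
      by auto
    have S\<kappa>: "(S \<circ> \<kappa>) i = dilation n" for i
      by (simp add: N(2) \<kappa>(2))
    have "C0_point (ball 0 1) (S \<circ> \<kappa>) z" if "z \<in> ball 0 1" for z
    proof -
      obtain r where "r > 0" "ball z r \<subseteq> ball 0 1"
        using openE[OF open_ball \<open>z \<in> ball 0 1\<close>] by blast
      moreover have "uniform_limit (ball z r) (\<lambda>i. sphere_val ((S \<circ> \<kappa>) i)) (sphere_val (dilation n)) sequentially"
        unfolding S\<kappa> by (rule uniform_limit_const)
      ultimately show ?thesis
        unfolding C0_point_def by blast
    qed
    then show ?thesis
      \<comment> \<open>A constant subsequence has no exceptional points, so the values of
        \<open>s\<close> and \<open>L\<close> are arbitrary here.\<close>
      using \<kappa>(1) by (intro exI[of _ \<kappa>] exI[of _ 0] exI[of _ "K 0"]) auto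
  next
    case 2
    have ks0: "filterlim (\<lambda>i. level (N i)) at_top sequentially"
      by (rule filterlim_compose[OF level_at_top 2])
    define ratio where "ratio i = scale (level (N i)) / real (N i)" for i
    have "ratio i \<in> {0..2}" for i
      using level_lower[OF N(1)[of i]] N(1)[of i] by (simp add: ratio_def divide_le_eq)
    then obtain s \<kappa>1 where s: "s \<in> {0..2}" "strict_mono \<kappa>1" "(ratio \<circ> \<kappa>1) \<longlonglongrightarrow> s"
      using compact_Icc[of 0 "2 :: real", unfolded compact_def, rule_format, of ratio] by blast
    define t where "t i = type_of (level (N (\<kappa>1 i)))" for i
    have ex: "\<exists>(\<kappa>2 :: nat \<Rightarrow> nat) L. strict_mono \<kappa>2 \<and> compact L \<and> ((\<exists>j. L = K j) \<or> L = {1} \<and> (\<exists>j. K j \<noteq> {})) \<and>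
      (\<forall>\<epsilon>>0. \<forall>\<^sub>F i in sequentially. \<forall>e\<in>clusters (level (N (\<kappa>1 (\<kappa>2 i)))). \<exists>l\<in>L. dist e l < \<epsilon>)"
    \<comment> \<open>The second alternative is the case of all \<open>K j\<close> empty; then all
      clusters are empty and the whole sequence serves with the empty limit set.\<close>
    proof (cases "\<exists>j. infinite {i. t i = j} \<or> K j = {} \<and> \<not> (\<exists>j. K j \<noteq> {})")
      case True
      then obtain j where j: "infinite {i. t i = j} \<or> (\<forall>j. K j = {})"
        by blast
      obtain \<kappa>2 :: "nat \<Rightarrow> nat" where \<kappa>2: "strict_mono \<kappa>2" "\<And>i. clusters (level (N (\<kappa>1 (\<kappa>2 i)))) \<subseteq> K j"
      proof (cases "\<forall>j. K j = {}")
        case True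
        then show ?thesis
          using that[of "\<lambda>i. i"] by (auto simp: clusters_def strict_mono_def)
      next
        case False
        then have "infinite {i. t i = j}"
          using j by blast
        then obtain \<kappa>2 :: "nat \<Rightarrow> nat" where \<kappa>2: "strict_mono \<kappa>2" "\<forall>i. \<kappa>2 i \<in> {i. t i = j}"
          using infinite_enumerate by blast
        then have "type_of (level (N (\<kappa>1 (\<kappa>2 i)))) = j" for i
          by (simp add: t_def)
        then have "clusters (level (N (\<kappa>1 (\<kappa>2 i)))) \<subseteq> K j" for i
          by (auto simp: clusters_def)
        with \<kappa>2(1) show ?thesis
          by (rule that)
      qed
      then have "\<exists>l\<in>K j. dist e l < \<epsilon>"
        if "e \<in> clusters (level (N (\<kappa>1 (\<kappa>2 i))))" "\<epsilon> > 0" for e i \<epsilon>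
        using that by (intro bexI[of _ e]) auto
      then show ?thesis
        using \<kappa>2(1) compact_K by (intro exI[of _ \<kappa>2] exI[of _ "K j"]) auto
    next
      case False
      then have "\<not> infinite {i. t i = j}" for j
        by blast
      then have "filterlim t at_top sequentially"
        by (metis nat_seq_cases)
      then have "\<forall>\<^sub>F i in sequentially. \<forall>e\<in>clusters (level (N (\<kappa>1 i))). dist e 1 < \<epsilon>" if "\<epsilon> > 0" for \<epsilon>
        using clusters_eventually_near[of "\<lambda>i. level (N (\<kappa>1 i))"] that by (simp add: t_def[abs_def])
      then show ?thesis
        using False by (intro exI[of _ "\<lambda>i. i"] exI[of _ "{1}"]) (auto simp: strict_mono_def)
    qed
    then obtain \<kappa>2 L where \<kappa>2: "strict_mono \<kappa>2" and L: "compact L"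
      "(\<exists>j. L = K j) \<or> L = {1} \<and> (\<exists>j. K j \<noteq> {})"
      "\<And>\<epsilon>. \<epsilon> > 0 \<Longrightarrow> \<forall>\<^sub>F i in sequentially. \<forall>e\<in>clusters (level (N (\<kappa>1 (\<kappa>2 i)))). \<exists>l\<in>L. dist e l < \<epsilon>"
      by blast
    define \<kappa> where "\<kappa> = \<kappa>1 \<circ> \<kappa>2"
    have \<kappa>: "strict_mono \<kappa>"
      unfolding \<kappa>_def using s(2) \<kappa>2 by (rule strict_mono_o)
    have ks: "filterlim (\<lambda>i. level (N (\<kappa> i))) at_top sequentially"
      using filterlim_compose[OF ks0 filterlim_subseq[OF \<kappa>]] .
    have lim: "(\<lambda>i. scale (level (N (\<kappa> i))) / N (\<kappa> i)) \<longlonglongrightarrow> s"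
      using LIMSEQ_subseq_LIMSEQ[OF s(3) \<kappa>2] by (simp add: o_def ratio_def \<kappa>_def)
    have "C0_point (ball 0 1) (S \<circ> \<kappa>) z"
      if z: "z \<in> ball 0 1" "z \<noteq> 0" "z \<notin> (*) (of_real s) ` L" for z
    proof -
      have "\<exists>d>0. ball z d \<subseteq> ball 0 1 \<and> uniform_limit (ball z d)
        (\<lambda>i. sphere_val (\<lambda>z. cluster_fun (of_nat (N (\<kappa> i)) * z))) (\<lambda>_. Infinity) sequentially"
      proof (rule uniform_limit_dilations_Infinity[OF ks _ _ lim L(1)])
        show "scale (level (N (\<kappa> i))) \<le> 2 * real (N (\<kappa> i))" for i
          by (intro level_lower N)
        show "2 * real (N (\<kappa> i)) \<le> scale (level (N (\<kappa> i)) + 1)" for i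
          using level_upper less_imp_le by blast
      qed (use L(3) z in \<open>auto simp: \<kappa>_def\<close>)
      then show ?thesis
        unfolding C0_point_def by (auto simp: N(2) dilation_def)
    qed
    then show ?thesis
      using \<kappa> s(1) L(2) by (intro exI[of _ \<kappa>] exI[of _ s] exI[of _ L]) auto
  qed
qed

text \<open>Along clusters of type \<open>j\<close>, dilation factors equal to twice the scale place
  the zeros exactly at halves of points of \<open>K j\<close>. Each such half is eventually a zero,
  while the dilations tend to infinity elsewhere. Passing to a subsequence destroys neither
  property.\<close>

lemma dilations_nonC0_sequence:
  "\<exists>S :: nat \<Rightarrow> complex \<Rightarrow> complex. range S \<subseteq> dilations cluster_fun \<and> (\<forall>(\<kappa> :: nat \<Rightarrow> nat) z. strict_mono \<kappa> \<longrightarrow>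
     z \<in> insert 0 ((*) (of_real (1 / 2)) ` K j) \<longrightarrow> \<not> C0_point (ball 0 1) (S \<circ> \<kappa>) z)"
proof -
  \<comment> \<open>The successor gives \<open>ks i > i\<close>, so the first \<open>ks i\<close>
    entries of the enumeration include the one with index \<open>i\<close>.\<close>
  define ks where "ks i = prod_encode (j, Suc i)" for i
  define N :: "nat \<Rightarrow> nat" where "N i = 2 * 4 ^ (ks i)\<^sup>2" for i
  have N: "real (N i) = 2 * scale (ks i)" for i
    by (simp add: N_def scale_def)
  have ks_ge: "Suc i \<le> ks i" for i
    unfolding ks_def by (rule le_prod_encode_2)
  have ks_type: "type_of (ks i) = j" for i
    by (simp add: type_of_def ks_def)
  have ks: "filterlim ks at_top sequentially"
    using ks_ge by (intro filterlim_at_top_mono[OF filterlim_Suc]) auto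
  define Z where "Z = insert 0 ((*) (of_real (1 / 2)) ` K j)"
  have lim: "(\<lambda>i. sphere_val (dilation (N i)) z) \<longlonglongrightarrow> Infinity" if z: "z \<in> ball 0 1 - Z" for z
  proof -
    have "\<exists>d>0. ball z d \<subseteq> ball 0 1 \<and> uniform_limit (ball z d)
        (\<lambda>i. sphere_val (\<lambda>z. cluster_fun (of_nat (N i) * z))) (\<lambda>_. Infinity) sequentially"
    proof (rule uniform_limit_dilations_Infinity[OF ks])
      fix i
      show "scale (ks i) \<le> 2 * real (N i)"
        using scale_pos[of "ks i"] by (simp add: N)
      have "(4 :: real) ^ 1 \<le> 4 ^ (2 * ks i + 1)"
        by (intro power_increasing) auto
      then show "2 * real (N i) \<le> scale (ks i + 1)"
        using scale_Suc[of "ks i"] by (simp add: N mult_right_mono)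
    next
      show "(\<lambda>i. scale (ks i) / real (N i)) \<longlonglongrightarrow> 1 / 2"
        by (simp add: N less_imp_neq[OF scale_pos, symmetric])
      show "\<forall>\<^sub>F i in sequentially. \<forall>e\<in>clusters (ks i). \<exists>l\<in>K j. dist e l < \<epsilon>" if "\<epsilon> > 0" for \<epsilon>
      proof (intro always_eventually allI ballI)
        fix i e assume "e \<in> clusters (ks i)"
        then show "\<exists>l\<in>K j. dist e l < \<epsilon>"
          using that by (intro bexI[of _ e]) (auto simp: clusters_def ks_type)
      qed
    qed (use z compact_K in \<open>auto simp: Z_def\<close>)
    then show ?thesis
      using tendsto_uniform_limitI unfolding dilation_def by fastforce
  qed
  have zero: "\<forall>\<^sub>F i in sequentially. dilation (N i) z = 0" if "z \<in> Z" for z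
  proof (cases "z = 0")
    case False
    then obtain e where e: "e \<in> K j" "z = e / 2"
      using \<open>z \<in> Z\<close> by (auto simp: Z_def)
    show ?thesis
    proof (rule eventually_sequentiallyI)
      fix i assume i: "to_nat_on (K j) e \<le> i"
      then have "to_nat_on (K j) e < ks i"
        using ks_ge[of i] by simp
      moreover have "e = from_nat_into (K j) (to_nat_on (K j) e)"
        using e(1) countable_K by simp
      ultimately have "e \<in> clusters (ks i)"
        using e(1) unfolding clusters_def ks_type by blast
      moreover have "of_nat (N i) * z = of_real (scale (ks i)) * e"
        by (simp add: N_def e(2) scale_def)
      ultimately show "dilation (N i) z = 0"
        using cluster_fun_zero by (simp add: dilation_def)
    qed
  qed (simp add: dilation_def)
  have "\<not> C0_point (ball 0 1) ((\<lambda>i. dilation (N i)) \<circ> \<kappa>) z" if "strict_mono \<kappa>" "z \<in> Z" for \<kappa> :: "nat \<Rightarrow> nat" and z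
  proof (rule not_C0_point_if_zero)
    show "((\<lambda>i. dilation (N i)) \<circ> \<kappa>) i holomorphic_on UNIV" for i
      by (simp add: holomorphic_dilation)
    show "\<forall>\<^sub>F i in sequentially. ((\<lambda>i. dilation (N i)) \<circ> \<kappa>) i z = 0"
      using eventually_compose_filterlim[OF zero[OF that(2)] filterlim_subseq[OF that(1)]] by simp
    show "countable Z"
      unfolding Z_def using countable_K by auto
    show "(\<lambda>i. sphere_val (((\<lambda>i. dilation (N i)) \<circ> \<kappa>) i) w) \<longlonglongrightarrow> Infinity" if "w \<in> ball 0 1 - Z" for w
      using LIMSEQ_subseq_LIMSEQ[OF lim[OF that] \<open>strict_mono \<kappa>\<close>] by (simp add: o_def)
  qed
  moreover have "range (\<lambda>i. dilation (N i)) \<subseteq> dilations cluster_fun"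
    by (intro image_subsetI dilation_in_dilations) (simp add: N_def)
  ultimately have "range (\<lambda>i. dilation (N i)) \<subseteq> dilations cluster_fun \<and> (\<forall>(\<kappa> :: nat \<Rightarrow> nat) z. strict_mono \<kappa> \<longrightarrow>
      z \<in> Z \<longrightarrow> \<not> C0_point (ball 0 1) ((\<lambda>i. dilation (N i)) \<circ> \<kappa>) z)"
    by blast
  then show ?thesis
    unfolding Z_def by (rule exI[where x = "\<lambda>i. dilation (N i)"])
qed

end

section \<open>Dilations with prescribed ranks\<close>

text \<open>The possible exceptional sets along a subsequence: a scaled \<open>G j\<close> with the
  origin, the origin with the limit of clusters whose types tend to infinity, or the origin alone.
  Only the first shape can carry nonzero ranks.\<close>

definition rank_limit ::
  "(nat \<Rightarrow> (complex \<times> countable_ordinal) set) \<Rightarrow> (complex \<times> countable_ordinal) set \<Rightarrow> bool" where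
  "rank_limit G H \<longleftrightarrow>
     (\<exists>s>0. \<exists>j. H = insert (0, 0) (apfst ((*) (complex_of_real s)) ` G j)) \<or>
     (\<exists>w. (\<exists>j. G j \<noteq> {}) \<and> H = {(0, 0), (w, 0)}) \<or>
     H = {(0, 0)}"

lemma fst_apfst_image: "fst ` apfst f ` G = f ` fst ` G"
  by (force simp: image_iff)

text \<open>This translates the analytic facts into ranks. The scattered condition bounds
  non-C-points from above along suitable subsequences; for one sequence per \<open>j\<close>, the
  attained condition bounds them from below along every subsequence.\<close>

lemma exists_dilations_ranks:
  assumes G: "\<And>j. countable (G j)" "\<And>j. scattered_ranks (G j)" "\<And>j. attained_ranks (G j)"
    "\<And>j. fst ` G j \<subseteq> cball 1 (1 / real (j + 2))"
  shows "\<exists>f. f holomorphic_on UNIV \<and>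
    (\<forall>S :: nat \<Rightarrow> complex \<Rightarrow> complex. range S \<subseteq> dilations f \<longrightarrow>
      (\<exists>(\<kappa> :: nat \<Rightarrow> nat) H. strict_mono \<kappa> \<and> rank_limit G H \<and>
        (\<forall>\<beta>. \<forall>z\<in>ball 0 1. (\<forall>a. (z, a) \<in> H \<longrightarrow> a < \<beta>) \<longrightarrow> C_point (ball 0 1) (S \<circ> \<kappa>) \<beta> z))) \<and>
    (\<forall>j. \<exists>S :: nat \<Rightarrow> complex \<Rightarrow> complex. range S \<subseteq> dilations f \<and>
      (\<forall>(\<kappa> :: nat \<Rightarrow> nat) z a \<beta>. strict_mono \<kappa> \<longrightarrow>
        (z, a) \<in> insert (0, 0) (apfst ((*) (complex_of_real (1 / 2))) ` G j) \<longrightarrow> \<beta> \<le> a \<longrightarrow>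
        \<not> C_point (ball 0 1) (S \<circ> \<kappa>) \<beta> z))"
proof -
  interpret cluster_family "\<lambda>j. fst ` G j"
    using G closed_fst_scattered_ranks by unfold_locales auto
  have "\<exists>(\<kappa> :: nat \<Rightarrow> nat) H. strict_mono \<kappa> \<and> rank_limit G H \<and>
      (\<forall>\<beta>. \<forall>z\<in>ball 0 1. (\<forall>a. (z, a) \<in> H \<longrightarrow> a < \<beta>) \<longrightarrow> C_point (ball 0 1) (S \<circ> \<kappa>) \<beta> z)"
    if S: "range S \<subseteq> dilations cluster_fun" for S :: "nat \<Rightarrow> complex \<Rightarrow> complex"
  proof -
    obtain \<kappa> :: "nat \<Rightarrow> nat" and s L where \<kappa>: "strict_mono \<kappa>" and "s \<ge> 0"
      and L: "(\<exists>j. L = fst ` G j) \<or> L = {1} \<and> (\<exists>j. fst ` G j \<noteq> {})"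
      and C0: "\<And>z. z \<in> ball 0 1 \<Longrightarrow> z \<noteq> 0 \<Longrightarrow> z \<notin> (*) (complex_of_real s) ` L \<Longrightarrow>
        C0_point (ball 0 1) (S \<circ> \<kappa>) z"
      using dilations_subsequence[OF S] by blast
    \<comment> \<open>Inclusion suffices, because \<open>H\<close> is only used to certify C-points;
      it may also rank points that are \<open>C_0\<close>.\<close>
    have "\<exists>H. rank_limit G H \<and> scattered_ranks H \<and> insert 0 ((*) (complex_of_real s) ` L) \<subseteq> fst ` H"
    proof (cases "s = 0")
      case True
      then show ?thesis
        \<comment> \<open>Multiplication by \<open>s = 0\<close> collapses the set \<open>L\<close>
          into the origin.\<close>
        by (intro exI[of _ "{(0, 0)}"]) (auto simp: rank_limit_def scattered_ranks_singleton)
    next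
      case False
      then have "s > 0"
        using \<open>s \<ge> 0\<close> by simp
      show ?thesis
      proof (cases "\<exists>j. L = fst ` G j")
        case True
        then obtain j where j: "L = fst ` G j"
          by blast
        define H where "H = insert (0, 0) (apfst ((*) (complex_of_real s)) ` G j)"
        have "scattered_ranks ({(0, 0)} \<union> apfst ((*) (complex_of_real s)) ` G j)"
          using G(2) \<open>s > 0\<close>
          by (intro scattered_ranks_Un scattered_ranks_singleton scattered_ranks_scale)
        then have "scattered_ranks H"
          by (simp add: H_def)
        moreover have "rank_limit G H"
          using \<open>s > 0\<close> unfolding rank_limit_def H_def by blast
        moreover have "insert 0 ((*) (complex_of_real s) ` L) \<subseteq> fst ` H"
          by (simp add: H_def j fst_apfst_image)
        ultimately show ?thesis
          by blast
      next
        case False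
        then have L1: "L = {1}" "\<exists>j. G j \<noteq> {}"
          using L by auto
        define H :: "(complex \<times> countable_ordinal) set" where "H = {(0, 0), (complex_of_real s, 0)}"
        have "scattered_ranks ({(0, 0)} \<union> {(complex_of_real s, 0)})"
          by (intro scattered_ranks_Un scattered_ranks_singleton)
        then have "scattered_ranks H"
          by (simp add: H_def insert_commute)
        moreover have "rank_limit G H"
          using L1(2) unfolding rank_limit_def H_def by blast
        moreover have "insert 0 ((*) (complex_of_real s) ` L) \<subseteq> fst ` H"
          by (simp add: H_def L1(1))
        ultimately show ?thesis
          by blast
      qed
    qed
    then obtain H where H: "rank_limit G H" "scattered_ranks H"
      "insert 0 ((*) (complex_of_real s) ` L) \<subseteq> fst ` H"
      by blast
    have "C_point (ball 0 1) (S \<circ> \<kappa>) \<beta> z"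
      if "z \<in> ball 0 1" "\<forall>a. (z, a) \<in> H \<longrightarrow> a < \<beta>" for \<beta> z
    proof (rule C_point_if_ranks_less[OF open_ball H(2)])
      show "C0_point (ball 0 1) (S \<circ> \<kappa>) w" if "w \<in> ball 0 1" "w \<notin> fst ` H" for w
        using C0[of w] H(3) that by blast
    qed (use that in auto)
    then show ?thesis
      using \<kappa> H(1) by blast
  qed
  moreover have "\<exists>S :: nat \<Rightarrow> complex \<Rightarrow> complex. range S \<subseteq> dilations cluster_fun \<and>
      (\<forall>(\<kappa> :: nat \<Rightarrow> nat) z a \<beta>. strict_mono \<kappa> \<longrightarrow>
        (z, a) \<in> insert (0, 0) (apfst ((*) (complex_of_real (1 / 2))) ` G j) \<longrightarrow> \<beta> \<le> a \<longrightarrow>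
        \<not> C_point (ball 0 1) (S \<circ> \<kappa>) \<beta> z)" for j
  proof -
    define H where "H = {(0, 0)} \<union> apfst ((*) (complex_of_real (1 / 2))) ` G j"
    have att: "attained_ranks H"
      unfolding H_def using G(3)
      by (intro attained_ranks_Un attained_ranks_zero attained_ranks_scale) auto
    have fst_H: "fst ` H = insert 0 ((*) (complex_of_real (1 / 2)) ` fst ` G j)"
      unfolding H_def image_Un fst_apfst_image by simp
    obtain S :: "nat \<Rightarrow> complex \<Rightarrow> complex" where S: "range S \<subseteq> dilations cluster_fun"
      "\<And>(\<kappa> :: nat \<Rightarrow> nat) z. strict_mono \<kappa> \<Longrightarrow> z \<in> fst ` H \<Longrightarrow> \<not> C0_point (ball 0 1) (S \<circ> \<kappa>) z"
      unfolding fst_H using dilations_nonC0_sequence[of j] by blast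
    have "\<not> C_point (ball 0 1) (S \<circ> \<kappa>) \<beta> z"
      if "strict_mono \<kappa>" "(z, a) \<in> H" "\<beta> \<le> a" for \<kappa> :: "nat \<Rightarrow> nat" and z a \<beta>
      using not_C_point_if_rank_ge[OF att S(2)[OF that(1)] that(2,3)] .
    then show ?thesis
      using S(1) by (intro exI[of _ S]) (simp add: H_def)
  qed
  ultimately show ?thesis
    using holomorphic_cluster_fun by blast
qed

section \<open>Q-normality and its order from the ranks\<close>

lemma rank_limit_less:
  assumes "rank_limit G H" "(z, a) \<in> H" "\<And>j w b. (w, b) \<in> G j \<Longrightarrow> b < \<alpha>" "0 < \<alpha>"
  shows "a < \<alpha>"
  using assms unfolding rank_limit_def by auto

text \<open>Let the top ranks of the \<open>G j\<close> run through all ordinals below \<alpha>.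
  Each limit set then has only ranks below \<alpha>, even for limit \<alpha>, since types tending to
  infinity leave only rank 0. Every \<beta> < \<alpha> occurs as the rank of the point 1/2, so
  \<beta> itself is too small.\<close>

lemma exists_dilations_Q_normal:
  fixes \<alpha> :: countable_ordinal
  assumes "0 < \<alpha>"
  shows "\<exists>f. f holomorphic_on UNIV \<and> Q_normal (ball 0 1) \<alpha> (dilations f) \<and>
    (\<forall>\<beta><\<alpha>. \<not> Q_normal (ball 0 1) \<beta> (dilations f))"
proof -
  have ne: "{..<\<alpha>} \<noteq> {}"
    using assms by blast
  define b where "b = from_nat_into {..<\<alpha>}"
  have b: "b j < \<alpha>" for j
    using from_nat_into[OF ne] by (auto simp: b_def)
  have "\<forall>j. \<exists>G. top_ranked (b j) 1 (1 / real (j + 2)) G"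
    by (intro allI exists_ranks_top) simp
  then obtain G where "\<forall>j. top_ranked (b j) 1 (1 / real (j + 2)) (G j)"
    by (rule choice[THEN exE])
  then have G: "\<And>j. countable (G j)" "\<And>j. scattered_ranks (G j)" "\<And>j. attained_ranks (G j)"
    "\<And>j. fst ` G j \<subseteq> cball 1 (1 / real (j + 2))" "\<And>j. (1, b j) \<in> G j"
    "\<And>j. \<forall>(z, a)\<in>G j. a \<le> b j \<and> (a = b j \<longrightarrow> z = 1)"
    unfolding top_ranked_def by blast+
  obtain f where f: "f holomorphic_on UNIV"
    "\<And>S :: nat \<Rightarrow> complex \<Rightarrow> complex. range S \<subseteq> dilations f \<Longrightarrow>
      (\<exists>(\<kappa> :: nat \<Rightarrow> nat) H. strict_mono \<kappa> \<and> rank_limit G H \<and>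
        (\<forall>\<beta>. \<forall>z\<in>ball 0 1. (\<forall>a. (z, a) \<in> H \<longrightarrow> a < \<beta>) \<longrightarrow> C_point (ball 0 1) (S \<circ> \<kappa>) \<beta> z))"
    "\<And>j. \<exists>S :: nat \<Rightarrow> complex \<Rightarrow> complex. range S \<subseteq> dilations f \<and>
      (\<forall>(\<kappa> :: nat \<Rightarrow> nat) z a \<beta>. strict_mono \<kappa> \<longrightarrow>
        (z, a) \<in> insert (0, 0) (apfst ((*) (complex_of_real (1 / 2))) ` G j) \<longrightarrow> \<beta> \<le> a \<longrightarrow>
        \<not> C_point (ball 0 1) (S \<circ> \<kappa>) \<beta> z)"
    using exists_dilations_ranks[OF G(1-4)] by blast
  have less: "a < \<alpha>" if "(w, a) \<in> G j" for w a j
    using G(6)[of j] b[of j] that by auto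
  have "Q_normal (ball 0 1) \<alpha> (dilations f)"
    unfolding Q_normal_def
  proof (intro allI impI)
    fix S :: "nat \<Rightarrow> complex \<Rightarrow> complex"
    assume S: "range S \<subseteq> dilations f"
    obtain \<kappa> :: "nat \<Rightarrow> nat" and H where \<kappa>: "strict_mono \<kappa>" "rank_limit G H"
      "\<And>\<beta> z. z \<in> ball 0 1 \<Longrightarrow> \<forall>a. (z, a) \<in> H \<longrightarrow> a < \<beta> \<Longrightarrow> C_point (ball 0 1) (S \<circ> \<kappa>) \<beta> z"
      using f(2)[OF S] by blast
    have "C_sequence (ball 0 1) \<alpha> (S \<circ> \<kappa>)"
      unfolding C_sequence_def
    proof
      fix z :: complex assume "z \<in> ball 0 1"
      then show "C_point (ball 0 1) (S \<circ> \<kappa>) \<alpha> z"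
        using rank_limit_less[OF \<kappa>(2) _ less assms] by (intro \<kappa>(3)) auto
    qed
    then show "\<exists>\<kappa>. strict_mono \<kappa> \<and> C_sequence (ball 0 1) \<alpha> (S \<circ> \<kappa>)"
      using \<kappa>(1) by blast
  qed
  moreover have "\<not> Q_normal (ball 0 1) \<beta> (dilations f)" if "\<beta> < \<alpha>" for \<beta>
  proof
    assume "Q_normal (ball 0 1) \<beta> (dilations f)"
    define j where "j = to_nat_on {..<\<alpha>} \<beta>"
    have "b j = \<beta>"
      using that countable_lessThan_countable_ordinal by (simp add: b_def j_def)
    then have "(1 / 2, \<beta>) \<in> insert (0, 0) (apfst ((*) (complex_of_real (1 / 2))) ` G j)"
      using G(5)[of j] by force
    moreover obtain S :: "nat \<Rightarrow> complex \<Rightarrow> complex" where S: "range S \<subseteq> dilations f"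
      "\<And>(\<kappa> :: nat \<Rightarrow> nat) z a \<beta>. strict_mono \<kappa> \<Longrightarrow>
        (z, a) \<in> insert (0, 0) (apfst ((*) (complex_of_real (1 / 2))) ` G j) \<Longrightarrow> \<beta> \<le> a \<Longrightarrow>
        \<not> C_point (ball 0 1) (S \<circ> \<kappa>) \<beta> z"
      using f(3)[of j] by blast
    moreover obtain \<kappa> :: "nat \<Rightarrow> nat" where "strict_mono \<kappa>" "C_sequence (ball 0 1) \<beta> (S \<circ> \<kappa>)"
      using \<open>Q_normal (ball 0 1) \<beta> (dilations f)\<close> S(1) unfolding Q_normal_def by blast
    moreover have "(1 / 2 :: complex) \<in> ball 0 1"
      by (simp add: norm_divide)
    ultimately show False
      unfolding C_sequence_def by blast
  qed
  ultimately show ?thesis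
    using f(1) by blast
qed

text \<open>Here \<open>m j\<close> counts the points of \<open>G j\<close> of the highest
  admissible rank \<open>opred \<alpha>\<close>. The origin has rank 0 and adds one to the count
  exactly when \<open>opred \<alpha>\<close> is 0, which \<open>c\<close> records.\<close>

lemma exists_dilations_Q_normal_order:
  fixes \<alpha> :: countable_ordinal and m :: "nat \<Rightarrow> nat"
  assumes \<alpha>: "has_pred \<alpha>"
  defines "c \<equiv> if opred \<alpha> = 0 then 1 else 0 :: nat"
  shows "\<exists>f. f holomorphic_on UNIV \<and> Q_normal (ball 0 1) \<alpha> (dilations f) \<and>
    (\<forall>\<nu>. 1 \<le> \<nu> \<longrightarrow> (\<forall>j. c + m j \<le> \<nu>) \<longrightarrow> Q_normal_order_le (ball 0 1) \<alpha> \<nu> (dilations f)) \<and>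
    (\<forall>j \<mu>. \<mu> < c + m j \<longrightarrow> \<not> Q_normal_order_le (ball 0 1) \<alpha> \<mu> (dilations f))"
proof -
  define \<gamma> where "\<gamma> = opred \<alpha>"
  have "\<gamma> < \<alpha>"
    unfolding \<gamma>_def using \<alpha> by (rule opred_less)
  have \<gamma>_max: "\<beta> \<le> \<gamma>" if "\<beta> < \<alpha>" for \<beta>
    unfolding \<gamma>_def using le_opred[OF \<alpha> that] .
  have "0 < \<alpha>"
    using \<open>\<gamma> < \<alpha>\<close> order_le_less_trans[OF zero_le_countable_ordinal] by blast
  have "\<forall>j. \<exists>G. countable G \<and> scattered_ranks G \<and> attained_ranks G \<and> fst ` G \<subseteq> cball 1 (1 / real (j + 2)) \<and>
    (\<forall>(z, a)\<in>G. a \<le> \<gamma>) \<and> finite {z. (z, \<gamma>) \<in> G} \<and> card {z. (z, \<gamma>) \<in> G} = m j \<and>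
    (G = {} \<longleftrightarrow> m j = 0)"
    by (intro allI exists_ranks_card) simp
  then obtain G where "\<forall>j. countable (G j) \<and> scattered_ranks (G j) \<and> attained_ranks (G j) \<and>
    fst ` G j \<subseteq> cball 1 (1 / real (j + 2)) \<and>
    (\<forall>(z, a)\<in>G j. a \<le> \<gamma>) \<and> finite {z. (z, \<gamma>) \<in> G j} \<and> card {z. (z, \<gamma>) \<in> G j} = m j \<and>
    (G j = {} \<longleftrightarrow> m j = 0)"
    by (rule choice[THEN exE])
  then have G: "\<And>j. countable (G j)" "\<And>j. scattered_ranks (G j)" "\<And>j. attained_ranks (G j)"
    "\<And>j. fst ` G j \<subseteq> cball 1 (1 / real (j + 2))" "\<And>j. \<forall>(z, a)\<in>G j. a \<le> \<gamma>"
    "\<And>j. finite {z. (z, \<gamma>) \<in> G j}" "\<And>j. card {z. (z, \<gamma>) \<in> G j} = m j"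
    "\<And>j. G j = {} \<longleftrightarrow> m j = 0"
    by blast+
  obtain f where f: "f holomorphic_on UNIV"
    "\<And>S :: nat \<Rightarrow> complex \<Rightarrow> complex. range S \<subseteq> dilations f \<Longrightarrow>
      (\<exists>(\<kappa> :: nat \<Rightarrow> nat) H. strict_mono \<kappa> \<and> rank_limit G H \<and>
        (\<forall>\<beta>. \<forall>z\<in>ball 0 1. (\<forall>a. (z, a) \<in> H \<longrightarrow> a < \<beta>) \<longrightarrow> C_point (ball 0 1) (S \<circ> \<kappa>) \<beta> z))"
    "\<And>j. \<exists>S :: nat \<Rightarrow> complex \<Rightarrow> complex. range S \<subseteq> dilations f \<and>
      (\<forall>(\<kappa> :: nat \<Rightarrow> nat) z a \<beta>. strict_mono \<kappa> \<longrightarrow>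
        (z, a) \<in> insert (0, 0) (apfst ((*) (complex_of_real (1 / 2))) ` G j) \<longrightarrow> \<beta> \<le> a \<longrightarrow>
        \<not> C_point (ball 0 1) (S \<circ> \<kappa>) \<beta> z)"
    using exists_dilations_ranks[OF G(1-4)] by blast
  have less: "a < \<alpha>" if "(w, a) \<in> G j" for w a j
    using G(5)[of j] \<open>\<gamma> < \<alpha>\<close> that by auto
  have scaled_mem: "(z, a) \<in> apfst ((*) (complex_of_real s)) ` G j \<longleftrightarrow> (\<exists>w. z = of_real s * w \<and> (w, a) \<in> G j)"
    for s z a j
    by force
  \<comment> \<open>The points of rank \<gamma> in a limit set of the first shape. For general
    \<open>s\<close> only an upper bound on their number is needed; for \<open>s = 1 / 2\<close> the
    number is exact.\<close>
  define scaled where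
    "scaled s j = (if \<gamma> = 0 then {0} else {}) \<union> (*) (complex_of_real s) ` {z. (z, \<gamma>) \<in> G j}" for s j
  have top_scaled: "{z. (z, \<gamma>) \<in> insert (0, 0) (apfst ((*) (complex_of_real s)) ` G j)} = scaled s j" for s j
    unfolding scaled_def insert_iff scaled_mem by auto
  have scaled: "finite (scaled s j)" "card (scaled s j) \<le> c + m j" for s j
  proof -
    show "finite (scaled s j)"
      unfolding scaled_def using G(6) by simp
    have "card (scaled s j) \<le> card (if \<gamma> = 0 then {0 :: complex} else {}) +
        card ((*) (complex_of_real s) ` {z. (z, \<gamma>) \<in> G j})"
      unfolding scaled_def by (rule card_Un_le)
    also have "\<dots> \<le> c + m j"
    proof (rule add_mono)
      show "card (if \<gamma> = 0 then {0 :: complex} else {}) \<le> c"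
        by (simp add: c_def \<gamma>_def)
      show "card ((*) (complex_of_real s) ` {z. (z, \<gamma>) \<in> G j}) \<le> m j"
        using card_image_le[OF G(6)[of j]] G(7)[of j] by simp
    qed
    finally show "card (scaled s j) \<le> c + m j" .
  qed
  have sub: "\<exists>\<kappa>. strict_mono \<kappa> \<and> C_sequence (ball 0 1) \<alpha> (S \<circ> \<kappa>) \<and>
      (\<exists>H. rank_limit G H \<and> nonC_points (ball 0 1) \<gamma> (S \<circ> \<kappa>) \<subseteq> {z. (z, \<gamma>) \<in> H})"
    if S: "range S \<subseteq> dilations f" for S :: "nat \<Rightarrow> complex \<Rightarrow> complex"
  proof -
    obtain \<kappa> :: "nat \<Rightarrow> nat" and H where \<kappa>: "strict_mono \<kappa>" "rank_limit G H"
      "\<And>\<beta> z. z \<in> ball 0 1 \<Longrightarrow> \<forall>a. (z, a) \<in> H \<longrightarrow> a < \<beta> \<Longrightarrow> C_point (ball 0 1) (S \<circ> \<kappa>) \<beta> z"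
      using f(2)[OF S] by blast
    have H: "a < \<alpha>" if "(z, a) \<in> H" for z a
      using rank_limit_less[OF \<kappa>(2) that less \<open>0 < \<alpha>\<close>] .
    then have "C_sequence (ball 0 1) \<alpha> (S \<circ> \<kappa>)"
      unfolding C_sequence_def by (intro ballI \<kappa>(3)) auto
    moreover have "nonC_points (ball 0 1) \<gamma> (S \<circ> \<kappa>) \<subseteq> {z. (z, \<gamma>) \<in> H}"
    proof
      fix z assume "z \<in> nonC_points (ball 0 1) \<gamma> (S \<circ> \<kappa>)"
      then obtain a where a: "(z, a) \<in> H" "\<not> a < \<gamma>"
        using \<kappa>(3)[of z \<gamma>] by (auto simp: nonC_points_def)
      then have "a = \<gamma>"
        using \<gamma>_max[OF H[OF a(1)]] by simp
      then show "z \<in> {z. (z, \<gamma>) \<in> H}"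
        using a by simp
    qed
    ultimately show ?thesis
      using \<kappa>(1,2) by blast
  qed
  have "Q_normal (ball 0 1) \<alpha> (dilations f)"
    unfolding Q_normal_def using sub by blast
  moreover have "Q_normal_order_le (ball 0 1) \<alpha> \<nu> (dilations f)"
    if \<nu>: "1 \<le> \<nu>" "\<And>j. c + m j \<le> \<nu>" for \<nu>
    unfolding Q_normal_order_le_def
  proof (intro allI impI)
    fix S :: "nat \<Rightarrow> complex \<Rightarrow> complex"
    assume "range S \<subseteq> dilations f"
    then obtain \<kappa> :: "nat \<Rightarrow> nat" and H where \<kappa>: "strict_mono \<kappa>" "C_sequence (ball 0 1) \<alpha> (S \<circ> \<kappa>)"
      "rank_limit G H" "nonC_points (ball 0 1) \<gamma> (S \<circ> \<kappa>) \<subseteq> {z. (z, \<gamma>) \<in> H}"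
      using sub by blast
    have "finite {z. (z, \<gamma>) \<in> H} \<and> card {z. (z, \<gamma>) \<in> H} \<le> \<nu>"
      using \<kappa>(3) unfolding rank_limit_def
    proof (elim disjE exE conjE)
      fix s j assume "H = insert (0, 0) (apfst ((*) (complex_of_real s)) ` G j)"
      then have "{z. (z, \<gamma>) \<in> H} = scaled s j"
        by (simp only: top_scaled)
      then show ?thesis
        using scaled[of s j] \<nu>(2)[of j] by simp
    next
      fix w j assume Gj: "G j \<noteq> {}" and H: "H = {(0, 0), (w, 0)}"
      show ?thesis
      \<comment> \<open>Only for \<gamma> = 0 do these points count. There are at most two, and the
        bound \<nu> is at least 2 because a nonempty \<open>G j\<close> gives \<open>m j\<close> at
        least 1, with the origin adding one more.\<close>
      proof (cases "\<gamma> = 0")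
        case True
        then have "{z. (z, \<gamma>) \<in> H} = {0, w}"
          by (auto simp: H)
        moreover have "c = 1" "m j \<noteq> 0"
          using True Gj G(8)[of j] by (auto simp: c_def \<gamma>_def)
        moreover have "card {0, w} \<le> 2"
          by (simp add: card_insert_if)
        ultimately show ?thesis
          using \<nu>(2)[of j] by simp
      next
        case False
        then show ?thesis
          by (simp add: H)
      qed
    next
      assume H: "H = {(0, 0)}"
      have "{z. (z, \<gamma>) \<in> H} \<subseteq> {0}"
        by (auto simp: H)
      then show ?thesis
        using \<nu>(1) card_mono[of "{0}" "{z. (z, \<gamma>) \<in> H}"]
          finite_subset[of "{z. (z, \<gamma>) \<in> H}" "{0}"] by simp
    qed
    then have "finite (nonC_points (ball 0 1) (opred \<alpha>) (S \<circ> \<kappa>)) \<and>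
        card (nonC_points (ball 0 1) (opred \<alpha>) (S \<circ> \<kappa>)) \<le> \<nu>"
      using finite_subset[OF \<kappa>(4)] card_mono[OF _ \<kappa>(4)] by (simp flip: \<gamma>_def)
    then show "\<exists>\<kappa>. strict_mono \<kappa> \<and> C_sequence (ball 0 1) \<alpha> (S \<circ> \<kappa>) \<and>
        finite (nonC_points (ball 0 1) (opred \<alpha>) (S \<circ> \<kappa>)) \<and>
        card (nonC_points (ball 0 1) (opred \<alpha>) (S \<circ> \<kappa>)) \<le> \<nu>"
      using \<kappa>(1,2) by blast
  qed
  moreover have "\<not> Q_normal_order_le (ball 0 1) \<alpha> \<mu> (dilations f)" if \<mu>: "\<mu> < c + m j" for j \<mu>
  proof
    assume Q: "Q_normal_order_le (ball 0 1) \<alpha> \<mu> (dilations f)"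
    obtain S :: "nat \<Rightarrow> complex \<Rightarrow> complex" where S: "range S \<subseteq> dilations f"
      "\<And>(\<kappa> :: nat \<Rightarrow> nat) z a \<beta>. strict_mono \<kappa> \<Longrightarrow>
        (z, a) \<in> insert (0, 0) (apfst ((*) (complex_of_real (1 / 2))) ` G j) \<Longrightarrow> \<beta> \<le> a \<Longrightarrow>
        \<not> C_point (ball 0 1) (S \<circ> \<kappa>) \<beta> z"
      using f(3)[of j] by blast
    obtain \<kappa> :: "nat \<Rightarrow> nat" where \<kappa>: "strict_mono \<kappa>"
      "finite (nonC_points (ball 0 1) \<gamma> (S \<circ> \<kappa>))" "card (nonC_points (ball 0 1) \<gamma> (S \<circ> \<kappa>)) \<le> \<mu>"
      using Q S(1) unfolding Q_normal_order_le_def \<gamma>_def by blast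
    \<comment> \<open>Halved points stay in the unit disk, and none of them coincides with the
      origin.\<close>
    have G_norm: "w \<noteq> 0" "norm w < 2" if "(w, \<gamma>) \<in> G j" for w
    proof -
      have "1 / real (j + 2) \<le> 1 / 2"
        by (simp add: field_simps)
      moreover have "dist 1 w \<le> 1 / real (j + 2)"
        using G(4)[of j] that by force
      ultimately have "norm (1 - w) \<le> 1 / 2"
        unfolding dist_norm by linarith
      then show "w \<noteq> 0" "norm w < 2"
        using norm_triangle_ineq2[of w 1] by (auto simp: norm_minus_commute)
    qed
    have "scaled (1 / 2) j \<subseteq> ball 0 1"
      unfolding scaled_def using G_norm(2) by (auto simp: norm_mult)
    moreover have "\<not> C_point (ball 0 1) (S \<circ> \<kappa>) \<gamma> z" if "z \<in> scaled (1 / 2) j" for z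
    proof (rule S(2)[OF \<kappa>(1)])
      show "(z, \<gamma>) \<in> insert (0, 0) (apfst ((*) (complex_of_real (1 / 2))) ` G j)"
        using that unfolding top_scaled[symmetric] by blast
    qed simp
    ultimately have "scaled (1 / 2) j \<subseteq> nonC_points (ball 0 1) \<gamma> (S \<circ> \<kappa>)"
      unfolding nonC_points_def by blast
    then have "card (scaled (1 / 2) j) \<le> \<mu>"
      by (rule order_trans[OF card_mono[OF \<kappa>(2)] \<kappa>(3)])
    moreover have "card (scaled (1 / 2) j) = c + m j"
    proof -
      define A where "A = (*) (complex_of_real (1 / 2)) ` {z. (z, \<gamma>) \<in> G j}"
      have "card A = m j"
        unfolding A_def using G(7)[of j] by (subst card_image) (auto simp: inj_on_def)
      moreover have "0 \<notin> A" "finite A"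
        using G_norm(1) G(6)[of j] by (auto simp: A_def)
      ultimately show ?thesis
        unfolding scaled_def A_def[symmetric] by (cases "\<gamma> = 0") (simp_all add: c_def flip: \<gamma>_def)
    qed
    ultimately show False
      using \<mu> by simp
  qed
  ultimately show ?thesis
    using f(1) by blast
qed

theorem theorem1:
  fixes \<alpha> :: countable_ordinal
  shows "(\<exists>f. f holomorphic_on UNIV \<and>
            Q_normal (ball 0 1) \<alpha> (dilations f) \<and>
            (\<forall>\<beta><\<alpha>. \<not> Q_normal (ball 0 1) \<beta> (dilations f))) \<and>
         (has_pred \<alpha> \<longrightarrow>
            (\<forall>\<nu>::nat. \<nu> \<ge> 1 \<longrightarrow>
               (\<exists>f. f holomorphic_on UNIV \<and>
                  Q_normal_exact_order (ball 0 1) \<alpha> \<nu> (dilations f))) \<and>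
            (\<exists>f. f holomorphic_on UNIV \<and>
               Q_normal_infinite_order (ball 0 1) \<alpha> (dilations f)))"
proof (intro conjI impI allI)
  show "\<exists>f. f holomorphic_on UNIV \<and> Q_normal (ball 0 1) \<alpha> (dilations f) \<and>
      (\<forall>\<beta><\<alpha>. \<not> Q_normal (ball 0 1) \<beta> (dilations f))"
  proof (cases "\<alpha> = 0")
    case True
    \<comment> \<open>No ordinal lies below 0, and the dilations of the zero function form a
      single-element family, so every sequence of them is constant.\<close>
    have "Q_normal (ball 0 1) 0 (dilations (\<lambda>_. 0))"
      unfolding Q_normal_def
    proof (intro allI impI)
      fix S :: "nat \<Rightarrow> complex \<Rightarrow> complex"
      assume "range S \<subseteq> dilations (\<lambda>_. 0)"
      then have S: "S = (\<lambda>_ _. 0)"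
        by (fastforce simp: dilations_def)
      have "C0_point (ball 0 1) S z" if "z \<in> ball 0 1" for z
      proof -
        obtain r where "r > 0" "ball z r \<subseteq> ball 0 1"
          using openE[OF open_ball \<open>z \<in> ball 0 1\<close>] by blast
        moreover have "uniform_limit (ball z r) (\<lambda>n. sphere_val (S n)) (sphere_val (\<lambda>_. 0)) sequentially"
          unfolding S by (rule uniform_limit_const)
        ultimately show ?thesis
          unfolding C0_point_def by blast
      qed
      then have "C_sequence (ball 0 1) 0 (S \<circ> id)"
        unfolding C_sequence_def C_point.simps[of _ _ 0] by simp
      then show "\<exists>k. strict_mono k \<and> C_sequence (ball 0 1) 0 (S \<circ> k)"
        using strict_mono_id by blast
    qed
    then show ?thesis
      using True leD[OF zero_le_countable_ordinal] by (intro exI[of _ "\<lambda>_. 0"]) auto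
  next
    case False
    then have "0 < \<alpha>"
      by (simp add: order_less_le)
    then show ?thesis
      by (rule exists_dilations_Q_normal)
  qed
next
  fix \<nu> :: nat assume \<alpha>: "has_pred \<alpha>" and "1 \<le> \<nu>"
  \<comment> \<open>When \<open>opred \<alpha>\<close> is 0 the origin already accounts for one
    exceptional point, so the clusters supply only the remaining \<open>\<nu> - c\<close>; for \<nu>
    = 1 they are then empty.\<close>
  define c :: nat where "c = (if opred \<alpha> = 0 then 1 else 0)"
  have "c + (\<nu> - c) = \<nu>"
    using \<open>1 \<le> \<nu>\<close> by (auto simp: c_def)
  then show "\<exists>f. f holomorphic_on UNIV \<and> Q_normal_exact_order (ball 0 1) \<alpha> \<nu> (dilations f)"
    using exists_dilations_Q_normal_order[OF \<alpha>, of "\<lambda>_. \<nu> - c"] \<open>1 \<le> \<nu>\<close>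
    unfolding Q_normal_exact_order_def c_def[symmetric] by fastforce
next
  assume \<alpha>: "has_pred \<alpha>"
  \<comment> \<open>Cluster sets with \<open>j\<close> top points for every \<open>j\<close> make
    the number of exceptional points unbounded over the family, though each limit set has finitely
    many.\<close>
  obtain f where f: "f holomorphic_on UNIV" "Q_normal (ball 0 1) \<alpha> (dilations f)"
    "\<And>j \<mu>. \<mu> < (if opred \<alpha> = 0 then 1 else 0) + j \<Longrightarrow> \<not> Q_normal_order_le (ball 0 1) \<alpha> \<mu> (dilations f)"
    using exists_dilations_Q_normal_order[OF \<alpha>, of "\<lambda>j. j"] by blast
  have "\<not> Q_normal_order_le (ball 0 1) \<alpha> \<nu> (dilations f)" for \<nu>
    using f(3)[of \<nu> "Suc \<nu>"] by simp
  then show "\<exists>f. f holomorphic_on UNIV \<and> Q_normal_infinite_order (ball 0 1) \<alpha> (dilations f)"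
    unfolding Q_normal_infinite_order_def using f by blast
qed

end
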